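(* Let $G$ be an $n$-vertex graph and let $A$ be any Hermitian weighted adjacency matrix of $G$. (i) If $G$ is $C_4$-free (contains no cycle of length 4 as a subgraph), then $n_{\ge 0}(A)\ge \beta n$, where $\beta=\sqrt3-\frac32$. (ii) If $G$ has girth at least $5$ (contains no cycle of length 3 or 4), then $n_{\ge 0}(A)\ge \frac n4$.
   Context: Graphs are finite and simple, with vertex set $\{1,\dots,n\}$. A Hermitian weighted adjacency matrix of $G$ is a Hermitian $n\times n$ complex matrix $A$ with $A_{ij}=0$ whenever $ij$ is not an edge of $G$ (in particular $A_{ii}=0$). For a Hermitian matrix $A$, $n_{\ge 0}(A)$ denotes the number of non-negative eigenvalues of $A$, counted with multiplicity. *)

theory Defs
  imports
    "Jordan_Normal_Form.Char_Poly"
    "Jordan_Normal_Form.Schur_Decomposition"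
    "Graph_Theory.Pair_Digraph"
    "HOL-Library.Extended_Nat"
    Complex_Main
begin

text \<open>
  A finite simple graph is a \<^locale>\<open>pair_graph\<close>: a finite, symmetric, loop-free digraph
  whose arcs are pairs of vertices, so that an edge ij is the pair of arcs (i,j), (j,i).
  The library notion of cycle also admits the closed walk a, b, a of length 2, which is not a
  cycle of the underlying undirected graph; hence the bound on the length below.
\<close>

definition graph_cycle :: "'a pair_pre_digraph \<Rightarrow> ('a \<times> 'a) awalk \<Rightarrow> bool" where
  "graph_cycle G p \<longleftrightarrow> pre_digraph.cycle (with_proj G) p \<and> 3 \<le> length p"

text \<open>Subgraphs need not be induced: chords of the 4-cycle are irrelevant.\<close>

definition C4_free :: "'a pair_pre_digraph \<Rightarrow> bool" where
  "C4_free G \<longleftrightarrow> \<not> (\<exists>p. graph_cycle G p \<and> length p = 4)"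

text \<open>The girth of a forest is \<open>\<infinity>\<close>, as the infimum of the empty set.\<close>

definition girth :: "'a pair_pre_digraph \<Rightarrow> enat" where
  "girth G = (INF p \<in> {p. graph_cycle G p}. enat (length p))"

lemma girth_ge_5_iff:
  "girth G \<ge> 5 \<longleftrightarrow> \<not> (\<exists>p. graph_cycle G p \<and> (length p = 3 \<or> length p = 4))"
proof -
  have "girth G \<ge> 5 \<longleftrightarrow> (\<forall>p. graph_cycle G p \<longrightarrow> 5 \<le> length p)"
    unfolding girth_def le_INF_iff by (auto simp: numeral_eq_enat)
  moreover have "graph_cycle G p \<Longrightarrow> 5 \<le> length p \<longleftrightarrow> \<not> (length p = 3 \<or> length p = 4)" for p
    by (auto simp: graph_cycle_def)
  ultimately show ?thesis by blast
qed

text \<open>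
  Vertices are numbered from 0, in accordance with the indices of the matrix type:
  the intended graphs satisfy \<open>pverts G = {0..<n}\<close>.
  The diagonal is covered, since (i,i) is never an arc of a loop-free graph.
\<close>

definition hermitian_weighted_adjacency :: "nat pair_pre_digraph \<Rightarrow> nat \<Rightarrow> complex mat \<Rightarrow> bool" where
  "hermitian_weighted_adjacency G n A \<longleftrightarrow>
     A \<in> carrier_mat n n \<and> mat_adjoint A = A \<and>
     (\<forall>i<n. \<forall>j<n. (i, j) \<notin> parcs G \<longrightarrow> A $$ (i, j) = 0)"

text \<open>
  Multiplicities are algebraic, which for a Hermitian matrix is the same as geometric.
  The condition \<open>k \<in> \<real>\<close> only matters for non-Hermitian matrices.
\<close>

definition num_nonneg_eigenvalues :: "complex mat \<Rightarrow> nat" where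
  "num_nonneg_eigenvalues A =
     (\<Sum>k | eigenvalue A k \<and> k \<in> \<real> \<and> 0 \<le> Re k. order k (char_poly A))"

end

theory Submission
  imports Defs "HOL-Analysis.Function_Topology"
begin

text \<open>
  Choose an independent set \<open>I\<close> of maximal size among those with at most \<open>card I\<close> neighbours, and let
  \<open>R\<close> consist of the vertices neither in \<open>I\<close> nor adjacent to it. The quadratic form of \<open>A\<close> vanishes
  on \<open>I\<close> and between \<open>I\<close> and \<open>R\<close>, so \<open>I\<close> contributes \<open>card I\<close> nonnegative eigenvalues on top of those
  from \<open>R\<close>, which pays for \<open>I\<close> and its neighbours. In \<open>R\<close> every nonempty independent set has strictly
  more neighbours than elements, so a diagonal congruence \<open>M\<close> of \<open>A\<close> on \<open>R\<close> has all row sums of squared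
  absolute values equal to 1. For such \<open>M\<close> the trace is 0, the trace of \<open>M\<^sup>2\<close> is \<open>card R\<close>, and, as two
  vertices have at most one common neighbour, the trace of \<open>M\<^sup>4\<close> is at most \<open>2 * card R\<close>; without
  triangles the trace of \<open>M\<^sup>3\<close> is 0 too. Summing over the spectrum a quartic polynomial below the
  indicator function of the positive reals then bounds the number of positive eigenvalues of \<open>M\<close>.
\<close>

section \<open>Spectral theorem for Hermitian matrices\<close>

text \<open>Gaussian elimination, one equation of \<open>Y\<close> at a time. It supplies the
  dimension count in \<open>nonneg_subspace_card_le\<close>.\<close>

lemma underdetermined_system:
  fixes a :: "'x \<Rightarrow> 'y \<Rightarrow> 'f :: field"
  assumes "finite Y" "finite X" "card Y < card X"
  shows "\<exists>c. (\<exists>x\<in>X. c x \<noteq> 0) \<and> (\<forall>y\<in>Y. (\<Sum>x\<in>X. c x * a x y) = 0)"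
  using assms
proof (induction Y arbitrary: X a rule: finite_induct)
  case empty
  then show ?case by (intro exI[of _ "\<lambda>_. 1"]) (auto simp: card_gt_0_iff)
next
  case (insert y Y)
  show ?case
  proof (cases "\<forall>x\<in>X. a x y = 0")
    case True
    moreover obtain c where "\<exists>x\<in>X. c x \<noteq> 0" "\<forall>y\<in>Y. (\<Sum>x\<in>X. c x * a x y) = 0"
      using insert.IH[of X a] insert.prems insert.hyps by auto
    ultimately show ?thesis by (intro exI[of _ c]) auto
  next
    case False
    then obtain x0 where x0: "x0 \<in> X" "a x0 y \<noteq> 0" by blast
    \<comment> \<open>Solving equation \<open>y\<close> for the unknown at \<open>x0\<close> and
      substituting into the remaining equations turns their coefficients into
      \<open>b\<close>.\<close>
    define b where "b x z = a x z - a x y / a x0 y * a x0 z" for x z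
    have "card Y < card (X - {x0})"
      using insert.prems insert.hyps x0 by simp
    then obtain c where c: "\<exists>x\<in>X - {x0}. c x \<noteq> 0" "\<And>z. z \<in> Y \<Longrightarrow> (\<Sum>x\<in>X - {x0}. c x * b x z) = 0"
      using insert.IH[of "X - {x0}" b] insert.prems by auto
    define s where "s = (\<Sum>x\<in>X - {x0}. c x * a x y)"
    define d where "d = c(x0 := - s / a x0 y)"
    have sum_d: "(\<Sum>x\<in>X. d x * a x z) = (\<Sum>x\<in>X - {x0}. c x * a x z) - s / a x0 y * a x0 z" for z
    proof -
      have "(\<Sum>x\<in>X. d x * a x z) = d x0 * a x0 z + (\<Sum>x\<in>X - {x0}. d x * a x z)"
        using insert.prems x0 by (simp add: sum.remove)
      also have "(\<Sum>x\<in>X - {x0}. d x * a x z) = (\<Sum>x\<in>X - {x0}. c x * a x z)"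
        by (intro sum.cong) (auto simp: d_def)
      finally show ?thesis by (simp add: d_def)
    qed
    have "(\<Sum>x\<in>X. d x * a x z) = (\<Sum>x\<in>X - {x0}. c x * b x z)" for z
      unfolding sum_d s_def b_def
      by (simp add: algebra_simps sum_subtractf sum_distrib_left sum_divide_distrib)
    moreover have "b x y = 0" for x using x0 by (simp add: b_def)
    ultimately have "\<forall>z\<in>insert y Y. (\<Sum>x\<in>X. d x * a x z) = 0"
      using c(2) by auto
    moreover have "\<exists>x\<in>X. d x \<noteq> 0" using c(1) by (auto simp: d_def)
    ultimately show ?thesis by blast
  qed
qed

section \<open>Adjoints and completion of a vector to a unitary matrix\<close>

lemma mat_adjoint_carrier [simp]:
  "M \<in> carrier_mat n m \<Longrightarrow> mat_adjoint M \<in> carrier_mat m n"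
  by (auto simp: mat_adjoint_def mat_of_rows_def)

lemma mat_adjoint_dim [simp]:
  "dim_row (mat_adjoint M) = dim_col M" "dim_col (mat_adjoint M) = dim_row M"
  by (auto simp: mat_adjoint_def)

lemma mat_adjoint_index [simp]:
  "i < dim_col M \<Longrightarrow> j < dim_row M \<Longrightarrow> mat_adjoint M $$ (i, j) = conjugate (M $$ (j, i))"
  by (simp add: mat_adjoint_def mat_of_rows_index)

lemma mat_adjoint_mult:
  fixes M N :: "complex mat"
  assumes "M \<in> carrier_mat n m" "N \<in> carrier_mat m k"
  shows "mat_adjoint (M * N) = mat_adjoint N * mat_adjoint M"
  using assms by (intro eq_matI) (auto simp: scalar_prod_def mult.commute)

lemma mat_adjoint_adjoint [simp]: "mat_adjoint (mat_adjoint M) = (M :: complex mat)"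
  by (intro eq_matI) auto

text \<open>Complete \<open>v\<close> to a basis, orthogonalise by Gram-Schmidt, which leaves the
  first vector unchanged, and divide each vector by its norm. The scalar \<open>c\<close> is the
  reciprocal of the norm of \<open>v\<close>.\<close>

lemma unitary_completion:
  fixes v :: "complex vec"
  assumes v: "v \<in> carrier_vec n" "v \<noteq> 0\<^sub>v n"
  shows "\<exists>W c. W \<in> carrier_mat n n \<and> mat_adjoint W * W = 1\<^sub>m n \<and> col W 0 = c \<cdot>\<^sub>v v"
proof -
  interpret cof_vec_space n "TYPE(complex)" .
  define b where "b = basis_completion v"
  define ws where "ws = gram_schmidt n b"
  from basis_completion[OF v, folded b_def]
  have dist_b: "distinct b"
    and indep: "\<not> lin_dep (set b)" and b: "set b \<subseteq> carrier_vec n" and hdb: "hd b = v"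
    and len_b: "length b = n" by auto
  have "n \<noteq> 0" using v by (metis carrier_vecD eq_vecI index_zero_vec(2) less_nat_zero_code)
  with hdb len_b obtain vs where bv: "b = v # vs" by (cases b, auto)
  from gram_schmidt_result[OF b dist_b indep refl, folded ws_def]
  have ws: "set ws \<subseteq> carrier_vec n" "corthogonal ws" "length ws = n"
    by (auto simp: len_b)
  from gram_schmidt_hd[OF v(1), of vs, folded bv] have "hd ws = v" unfolding ws_def .
  then have ws0: "ws ! 0 = v" using ws(3) \<open>n \<noteq> 0\<close> by (metis hd_conv_nth list.size(3))
  define q where "q i = (\<Sum>k<n. (cmod (ws ! i $ k))\<^sup>2)" for i
  have ip: "ws ! j \<bullet>c ws ! i = (\<Sum>k<n. ws ! j $ k * cnj (ws ! i $ k))" if "i < n" "j < n" for i j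
  proof -
    have "ws ! i \<in> carrier_vec n" "ws ! j \<in> carrier_vec n"
      using ws(1,3) that nth_mem[of i ws] nth_mem[of j ws] by auto
    then show ?thesis by (auto simp: scalar_prod_def lessThan_atLeast0)
  qed
  have q: "ws ! i \<bullet>c ws ! i = of_real (q i)" if "i < n" for i
    unfolding q_def ip[OF that that] by (simp add: complex_norm_square del: of_real_power)
  have q_pos: "q i > 0" if "i < n" for i
  proof -
    have "q i \<noteq> 0" using corthogonalD[OF ws(2), of i i] q[OF that] that ws(3) by auto
    moreover have "q i \<ge> 0" by (auto simp: q_def intro: sum_nonneg)
    ultimately show ?thesis by simp
  qed
  define W where "W = mat n n (\<lambda>(k, i). ws ! i $ k / of_real (sqrt (q i)))"
  have W: "W \<in> carrier_mat n n" by (simp add: W_def)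
  have "mat_adjoint W * W = 1\<^sub>m n"
  proof (intro eq_matI)
    fix i j assume "i < dim_row (1\<^sub>m n :: complex mat)" "j < dim_col (1\<^sub>m n :: complex mat)"
    then have ij: "i < n" "j < n" by auto
    have "(mat_adjoint W * W) $$ (i, j) = (\<Sum>k<n. cnj (W $$ (k, i)) * W $$ (k, j))"
      using ij W by (simp add: scalar_prod_def lessThan_atLeast0)
    also have "\<dots> = (\<Sum>k<n. ws ! j $ k * cnj (ws ! i $ k)) / of_real (sqrt (q i) * sqrt (q j))"
      using ij by (simp add: W_def sum_divide_distrib mult.commute)
    also have "\<dots> = (ws ! j \<bullet>c ws ! i) / of_real (sqrt (q i) * sqrt (q j))"
      using ip[OF ij] by simp
    also have "\<dots> = 1\<^sub>m n $$ (i, j)"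
      using corthogonalD[OF ws(2), of j i] ij ws(3) q[of i] q_pos[of i]
      by (cases "i = j") auto
    finally show "(mat_adjoint W * W) $$ (i, j) = 1\<^sub>m n $$ (i, j)" .
  qed (use W in auto)
  moreover have "col W 0 = (1 / of_real (sqrt (q 0))) \<cdot>\<^sub>v v"
    using \<open>n \<noteq> 0\<close> v ws0 by (intro eq_vecI) (auto simp: W_def)
  ultimately show ?thesis using W by blast
qed

text \<open>The diagonal is real by type, so that \<open>hermitian_spectral\<close> includes the
  reality of the eigenvalues.\<close>

definition diag_of :: "nat \<Rightarrow> (nat \<Rightarrow> real) \<Rightarrow> complex mat" where
  "diag_of n l = mat n n (\<lambda>(i, j). if i = j then of_real (l i) else 0)"

lemma diag_of_carrier [simp]: "diag_of n l \<in> carrier_mat n n"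
  and diag_of_dim [simp]: "dim_row (diag_of n l) = n" "dim_col (diag_of n l) = n"
  by (simp_all add: diag_of_def)

lemma hermitian_conj_unitary:
  fixes A W :: "complex mat"
  assumes "A \<in> carrier_mat n n" "mat_adjoint A = A" "W \<in> carrier_mat n n"
  shows "mat_adjoint (mat_adjoint W * A * W) = mat_adjoint W * A * W"
proof -
  have "mat_adjoint (mat_adjoint W * A * W) = mat_adjoint W * mat_adjoint (mat_adjoint W * A)"
    using assms by (intro mat_adjoint_mult[of _ n n _ n]) auto
  also have "mat_adjoint (mat_adjoint W * A) = A * W"
    using assms by (subst mat_adjoint_mult[of _ n n _ n]) auto
  finally show ?thesis using assms by (simp add: assoc_mult_mat[of _ n n _ n _ n])
qed

text \<open>Deflation: take a unitary \<open>W\<close> whose first column is an eigenvector.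
  Conjugation by \<open>W\<close> clears the rest of the first column, and by symmetry of the first
  row, which leaves a smaller Hermitian block \<open>C\<close> for the induction.\<close>

theorem hermitian_spectral:
  fixes A :: "complex mat"
  assumes "A \<in> carrier_mat n n" "mat_adjoint A = A"
  shows "\<exists>U l. U \<in> carrier_mat n n \<and> mat_adjoint U * U = 1\<^sub>m n \<and> A = U * diag_of n l * mat_adjoint U"
  using assms
proof (induction n arbitrary: A)
  case 0
  then show ?case
    by (intro exI[of _ "1\<^sub>m 0"] exI[of _ "\<lambda>_. 0"]) (auto intro!: eq_matI)
next
  case (Suc n A)
  let ?N = "Suc n"
  note A = Suc.prems(1) and herm = Suc.prems(2)
  obtain as where "char_poly A = (\<Prod> a \<leftarrow> as. [:- a, 1:])" "length as = ?N"
    using char_poly_factorized[OF A] by blast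
  then obtain e where "poly (char_poly A) e = 0" by (cases as) auto
  then have "eigenvalue A e" using eigenvalue_root_char_poly[OF A] by simp
  then obtain v where v: "v \<in> carrier_vec ?N" "v \<noteq> 0\<^sub>v ?N" "A *\<^sub>v v = e \<cdot>\<^sub>v v"
    using A by (auto simp: eigenvalue_def eigenvector_def)
  obtain W c where W: "W \<in> carrier_mat ?N ?N" "mat_adjoint W * W = 1\<^sub>m ?N" and c: "col W 0 = c \<cdot>\<^sub>v v"
    using unitary_completion[OF v(1,2)] by blast
  have W': "mat_adjoint W \<in> carrier_mat ?N ?N" using W by simp
  have WW': "W * mat_adjoint W = 1\<^sub>m ?N"
    by (rule mat_mult_left_right_inverse[OF W' W(1) W(2)])
  define B where "B = mat_adjoint W * A * W"
  have B: "B \<in> carrier_mat ?N ?N" using A W unfolding B_def by auto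
  have hermB: "mat_adjoint B = B" unfolding B_def by (rule hermitian_conj_unitary[OF A herm W(1)])
  have Wcol: "A *\<^sub>v col W 0 = e \<cdot>\<^sub>v col W 0"
    using v A unfolding c by (simp add: mult_mat_vec smult_smult_assoc mult.commute)
  \<comment> \<open>The first column of \<open>A * W\<close> is \<open>e\<close> times that of
    \<open>W\<close>, so the first column of \<open>B\<close> is \<open>e\<close> times that of
    \<open>mat_adjoint W * W\<close>, the identity.\<close>
  have col0: "B $$ (i, 0) = (if i = 0 then e else 0)" if i: "i < ?N" for i
  proof -
    have "B $$ (i, 0) = (mat_adjoint W * (A * W)) $$ (i, 0)"
      using A W unfolding B_def by (simp add: assoc_mult_mat[of _ ?N ?N _ ?N _ ?N])
    also have "\<dots> = row (mat_adjoint W) i \<bullet> col (A * W) 0"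
      using A W i by (intro index_mult_mat(1)) auto
    also have "col (A * W) 0 = A *\<^sub>v col W 0"
      by (rule col_mult2[OF A W(1)]) simp
    also have "row (mat_adjoint W) i \<bullet> (A *\<^sub>v col W 0) = e * (row (mat_adjoint W) i \<bullet> col W 0)"
      unfolding Wcol using W i by (simp add: scalar_prod_smult_distrib[of _ ?N])
    also have "row (mat_adjoint W) i \<bullet> col W 0 = (mat_adjoint W * W) $$ (i, 0)"
      using W(1) i by simp
    finally show ?thesis using i unfolding W(2) by simp
  qed
  have herm_entry: "B $$ (i, j) = cnj (B $$ (j, i))" if "i < ?N" "j < ?N" for i j
    using arg_cong[OF hermB, of "\<lambda>M. M $$ (i, j)"] that B by simp
  define C where "C = mat n n (\<lambda>(i, j). B $$ (Suc i, Suc j))"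
  have C: "C \<in> carrier_mat n n" by (simp add: C_def)
  have "mat_adjoint C = C"
  proof (rule eq_matI)
    fix i j assume "i < dim_row C" "j < dim_col C"
    then show "mat_adjoint C $$ (i, j) = C $$ (i, j)"
      using herm_entry[of "Suc i" "Suc j"] by (simp add: C_def)
  qed (auto simp: C_def)
  from Suc.IH[OF C this] obtain V l
    where V: "V \<in> carrier_mat n n" "mat_adjoint V * V = 1\<^sub>m n" and Cl: "C = V * diag_of n l * mat_adjoint V"
    by blast
  have e_real: "cnj e = e" using herm_entry[of 0 0] col0[of 0] by simp
  define l' where "l' i = (case i of 0 \<Rightarrow> Re e | Suc j \<Rightarrow> l j)" for i
  \<comment> \<open>Block diagonal matrices with a scalar corner are multiplied and adjoined
    blockwise. Hence the diagonalization of \<open>C\<close> by \<open>V\<close> lifts to one of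
    \<open>B\<close> by \<open>P\<close>, and \<open>W * P\<close> diagonalizes
    \<open>A\<close>.\<close>
  let ?blk = "\<lambda>a M. four_block_mat (mat 1 1 (\<lambda>_. a)) (0\<^sub>m 1 n) (0\<^sub>m n 1) M :: complex mat"
  have blk_mult: "?blk a M * ?blk b M' = ?blk (a * b) (M * M')"
    if "M \<in> carrier_mat n n" "M' \<in> carrier_mat n n" for a b M M'
  proof -
    have 1: "mat 1 1 (\<lambda>_. a) * mat 1 1 (\<lambda>_. b) + 0\<^sub>m 1 n * 0\<^sub>m n 1 = mat 1 1 (\<lambda>_. a * b)"
      by (rule eq_matI) (auto simp: scalar_prod_def)
    have 2: "mat 1 1 (\<lambda>_. a) * 0\<^sub>m 1 n + 0\<^sub>m 1 n * M' = 0\<^sub>m 1 n"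
      using that by (intro eq_matI) (auto simp: scalar_prod_def)
    have 3: "0\<^sub>m n 1 * mat 1 1 (\<lambda>_. b) + M * 0\<^sub>m n 1 = 0\<^sub>m n 1"
      using that by (intro eq_matI) (auto simp: scalar_prod_def)
    have 4: "0\<^sub>m n 1 * 0\<^sub>m 1 n + M * M' = M * M'"
      using that by (intro eq_matI) (auto simp: scalar_prod_def)
    show ?thesis
      by (subst mult_four_block_mat[of _ 1 1 _ n _ n _ _ 1 _ n])
        (use that in \<open>simp_all only: 1 2 3 4, auto\<close>)
  qed
  have blk_adj: "mat_adjoint (?blk a M) = ?blk (cnj a) (mat_adjoint M)" if "M \<in> carrier_mat n n" for a M
    using that by (intro eq_matI) auto
  have Bblk: "B = ?blk e C"
  proof (rule eq_matI)
    fix i j assume "i < dim_row (?blk e C)" "j < dim_col (?blk e C)"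
    then have "i < ?N" "j < ?N" by (auto simp: C_def)
    then show "B $$ (i, j) = ?blk e C $$ (i, j)"
      using col0[of i] col0[of j] herm_entry[of i j] e_real
      by (cases i; cases j) (auto simp: C_def)
  qed (use B in \<open>auto simp: C_def\<close>)
  have Dblk: "diag_of ?N l' = ?blk e (diag_of n l)"
  proof (rule eq_matI)
    fix i j assume "i < dim_row (?blk e (diag_of n l))" "j < dim_col (?blk e (diag_of n l))"
    then show "diag_of ?N l' $$ (i, j) = ?blk e (diag_of n l) $$ (i, j)"
      using e_real by (cases i; cases j) (auto simp: diag_of_def l'_def complex_eq_iff)
  qed auto
  define P where "P = ?blk 1 V"
  have P: "P \<in> carrier_mat ?N ?N" using V by (auto simp: P_def)
  have P': "mat_adjoint P = ?blk 1 (mat_adjoint V)" using blk_adj[OF V(1), of 1] by (simp only: P_def complex_cnj_one)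
  have one_blk: "1\<^sub>m ?N = ?blk 1 (1\<^sub>m n)"
  proof (rule eq_matI)
    fix i j assume "i < dim_row (?blk 1 (1\<^sub>m n))" "j < dim_col (?blk 1 (1\<^sub>m n))"
    then show "1\<^sub>m ?N $$ (i, j) = ?blk 1 (1\<^sub>m n) $$ (i, j)"
      by (cases i; cases j) auto
  qed auto
  have "?blk 1 (mat_adjoint V) * ?blk 1 V = ?blk (1 * 1) (mat_adjoint V * V)"
    by (rule blk_mult) (use V in auto)
  then have P'P: "mat_adjoint P * P = 1\<^sub>m ?N"
    unfolding P' one_blk unfolding P_def V(2) mult_1_right .
  have "?blk 1 V * ?blk e (diag_of n l) * ?blk 1 (mat_adjoint V) =
      ?blk (1 * e) (V * diag_of n l) * ?blk 1 (mat_adjoint V)"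
    by (subst blk_mult) (use V in auto)
  also have "\<dots> = ?blk (1 * e * 1) (V * diag_of n l * mat_adjoint V)"
    by (rule blk_mult) (use V in auto)
  finally have BP: "B = P * diag_of ?N l' * mat_adjoint P"
    unfolding P' unfolding Bblk Dblk Cl P_def mult_1 mult_1_right by (rule sym)
  have P'c: "mat_adjoint P \<in> carrier_mat ?N ?N" using P by simp
  note assoc = assoc_mult_mat[of _ ?N ?N _ ?N _ ?N]
  have "mat_adjoint (W * P) * (W * P) = mat_adjoint P * (mat_adjoint W * W) * P"
    unfolding mat_adjoint_mult[OF W(1) P] using W(1) P P'c W'
    by (simp add: assoc mult_carrier_mat[of _ ?N ?N _ ?N])
  then have "mat_adjoint (W * P) * (W * P) = 1\<^sub>m ?N" 
    using P'P by (simp only: W(2) right_mult_one_mat[OF P'c])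
  moreover have "A = (W * P) * diag_of ?N l' * mat_adjoint (W * P)"
  proof -
    have "A = (W * mat_adjoint W) * A * (W * mat_adjoint W)" using A by (simp add: WW')
    also have "\<dots> = W * B * mat_adjoint W" using A W(1) W' by (simp add: B_def assoc mult_carrier_mat[of _ ?N ?N _ ?N])
    also have "\<dots> = (W * P) * diag_of ?N l' * mat_adjoint (W * P)"
      unfolding BP mat_adjoint_mult[OF W(1) P] using W(1) W' P P'c
      by (simp add: assoc mult_carrier_mat[of _ ?N ?N _ ?N])
    finally show ?thesis .
  qed
  ultimately show ?case using W P by (intro exI[of _ "W * P"] exI[of _ l']) auto
qed

section \<open>Traces, multiplicities and eigenvalues of a diagonalized matrix\<close>

definition mat_trace :: "'a :: comm_monoid_add mat \<Rightarrow> 'a" where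
  "mat_trace M = (\<Sum>i<dim_row M. M $$ (i, i))"

lemma mat_trace_mult:
  fixes M N :: "'a :: comm_semiring_0 mat"
  assumes "M \<in> carrier_mat n m" "N \<in> carrier_mat m n"
  shows "mat_trace (M * N) = (\<Sum>i<n. \<Sum>j<m. M $$ (i, j) * N $$ (j, i))"
  using assms unfolding mat_trace_def by (auto simp: scalar_prod_def lessThan_atLeast0 intro!: sum.cong)

lemma mat_trace_comm:
  fixes M N :: "'a :: comm_semiring_0 mat"
  assumes "M \<in> carrier_mat n m" "N \<in> carrier_mat m n"
  shows "mat_trace (M * N) = mat_trace (N * M)"
  unfolding mat_trace_mult[OF assms] mat_trace_mult[OF assms(2,1)]
  by (subst sum.swap) (simp add: mult.commute)

text \<open>Turns algebraic multiplicities into numbers of indices; orders add up over the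
  factors.\<close>

lemma order_prod_linear_factors:
  fixes l :: "nat \<Rightarrow> 'a :: idom"
  shows "order k (\<Prod>i<n. [:- l i, 1:]) = card {i. i < n \<and> l i = k}"
proof (induction n)
  case 0
  then show ?case by (simp add: order_0I)
next
  case (Suc n)
  have ne: "(\<Prod>i<n. [:- l i, 1:]) * [:- l n, 1:] \<noteq> 0"
    unfolding mult_eq_0_iff by simp
  have "{i. i < Suc n \<and> l i = k} = {i. i < n \<and> l i = k} \<union> (if l n = k then {n} else {})"
    by (auto simp: less_Suc_eq)
  then have "card {i. i < Suc n \<and> l i = k} = card {i. i < n \<and> l i = k} + (if l n = k then 1 else 0)"
    by (auto simp: card_insert_if)
  moreover have "order k [:- l n, 1:] = (if l n = k then 1 else 0)"
    using order_power_n_n[of k 1] by (auto intro: order_0I)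
  ultimately show ?case using order_mult[OF ne, of k] Suc.IH by simp
qed

text \<open>The columns of \<open>U\<close> form an orthonormal eigenbasis, and \<open>l\<close>
  lists the eigenvalues with repetition.\<close>

locale hermitian_diagonalization =
  fixes n :: nat and A U :: "complex mat" and l :: "nat \<Rightarrow> real"
  assumes U: "U \<in> carrier_mat n n" and UU: "mat_adjoint U * U = 1\<^sub>m n"
    and A_eq: "A = U * diag_of n l * mat_adjoint U"
begin

lemma UU': "U * mat_adjoint U = 1\<^sub>m n"
  using U UU by (intro mat_mult_left_right_inverse[of "mat_adjoint U"]) auto

lemma A_carrier: "A \<in> carrier_mat n n"
  using U by (auto simp: A_eq)

lemma orthonormal_columns:
  assumes "j < n" "k < n"
  shows "(\<Sum>i<n. cnj (U $$ (i, j)) * U $$ (i, k)) = (if j = k then 1 else 0)"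
  using arg_cong[OF UU, of "\<lambda>M. M $$ (j, k)"] assms U
  by (simp add: scalar_prod_def lessThan_atLeast0)

lemma orthonormal_rows:
  assumes "i < n" "k < n"
  shows "(\<Sum>j<n. U $$ (i, j) * cnj (U $$ (k, j))) = (if i = k then 1 else 0)"
  using arg_cong[OF UU', of "\<lambda>M. M $$ (i, k)"] assms U
  by (simp add: scalar_prod_def lessThan_atLeast0)

lemma A_entry:
  assumes "i < n" "k < n"
  shows "A $$ (i, k) = (\<Sum>j<n. of_real (l j) * (U $$ (i, j) * cnj (U $$ (k, j))))"
proof -
  have "(U * diag_of n l) $$ (i, j) = of_real (l j) * U $$ (i, j)" if "j < n" for j
  proof -
    have "(U * diag_of n l) $$ (i, j) = (\<Sum>m<n. if m = j then U $$ (i, j) * of_real (l j) else 0)"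
    proof -
      have "(U * diag_of n l) $$ (i, j) = (\<Sum>m<n. U $$ (i, m) * (if m = j then of_real (l m) else 0))"
        using assms U that by (simp add: scalar_prod_def lessThan_atLeast0 diag_of_def)
      also have "\<dots> = (\<Sum>m<n. if m = j then U $$ (i, j) * of_real (l j) else 0)"
        by (intro sum.cong refl) auto
      finally show ?thesis .
    qed
    then show ?thesis using that by (simp add: mult.commute)
  qed
  moreover have "A $$ (i, k) = (\<Sum>j<n. (U * diag_of n l) $$ (i, j) * cnj (U $$ (k, j)))"
    using assms U unfolding A_eq by (simp add: scalar_prod_def lessThan_atLeast0)
  ultimately show ?thesis by (simp add: mult.assoc)
qed

lemma eigenvector_column:
  assumes "i < n" "j < n"
  shows "(\<Sum>k<n. A $$ (i, k) * U $$ (k, j)) = of_real (l j) * U $$ (i, j)"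
proof -
  have "(\<Sum>k<n. A $$ (i, k) * U $$ (k, j)) =
      (\<Sum>k<n. \<Sum>m<n. of_real (l m) * U $$ (i, m) * (cnj (U $$ (k, m)) * U $$ (k, j)))"
    using assms(1) by (intro sum.cong refl) (simp add: A_entry sum_distrib_right mult.assoc)
  also have "\<dots> = (\<Sum>m<n. of_real (l m) * U $$ (i, m) * (\<Sum>k<n. cnj (U $$ (k, m)) * U $$ (k, j)))"
    unfolding sum_distrib_left by (rule sum.swap)
  also have "\<dots> = (\<Sum>m<n. if m = j then of_real (l j) * U $$ (i, j) else 0)"
    using assms(2) by (intro sum.cong refl) (simp add: orthonormal_columns)
  finally show ?thesis using assms(2) by simp
qed

lemma char_poly_A: "char_poly A = (\<Prod>i<n. [:- of_real (l i), 1:])"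
proof -
  have "similar_mat_wit A (diag_of n l) U (mat_adjoint U)"
    by (rule similar_mat_witI[OF UU' UU A_eq A_carrier]) (use U in auto)
  then have "char_poly A = char_poly (diag_of n l)"
    by (intro char_poly_similar) (auto simp: similar_mat_def)
  also have "\<dots> = (\<Prod>a\<leftarrow>diag_mat (diag_of n l). [:- a, 1:])"
    by (rule char_poly_upper_triangular[of _ n]) (auto simp: diag_of_def)
  also have "diag_mat (diag_of n l) = map (\<lambda>i. of_real (l i)) [0..<n]"
    by (auto simp: diag_mat_def diag_of_def)
  finally show ?thesis
    using prod.distinct_set_conv_list[of "[0..<n]" "\<lambda>i. [:- complex_of_real (l i), 1:]"]
    by (simp add: comp_def lessThan_atLeast0)
qed

text \<open>Group the indices by the value of \<open>l\<close>: the size of each class is the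
  multiplicity of that eigenvalue.\<close>

lemma num_nonneg_eigenvalues_eq: "num_nonneg_eigenvalues A = card {j. j < n \<and> 0 \<le> l j}"
proof -
  let ?T = "{k. eigenvalue A k \<and> k \<in> \<real> \<and> 0 \<le> Re k}" and ?S = "{j. j < n \<and> 0 \<le> l j}"
  have ev: "eigenvalue A k \<longleftrightarrow> (\<exists>j<n. k = of_real (l j))" for k
    unfolding eigenvalue_root_char_poly[OF A_carrier] char_poly_A
    by (auto simp: poly_prod)
  have T: "?T = (\<lambda>j. of_real (l j)) ` ?S" by (auto simp: ev)
  have "num_nonneg_eigenvalues A = (\<Sum>k\<in>?T. card {j. j < n \<and> of_real (l j) = k})"
    unfolding num_nonneg_eigenvalues_def char_poly_A
    by (simp only: order_prod_linear_factors[of _ "\<lambda>i. complex_of_real (l i)"])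
  also have "\<dots> = (\<Sum>k\<in>?T. \<Sum>j\<in>{j\<in>?S. of_real (l j) = k}. 1)"
  proof (intro sum.cong refl)
    fix k assume "k \<in> ?T"
    then have "{j. j < n \<and> of_real (l j) = k} = {j \<in> ?S. of_real (l j) = k}" by auto
    then show "card {j. j < n \<and> of_real (l j) = k} = (\<Sum>j\<in>{j \<in> ?S. of_real (l j) = k}. 1)"
      by (simp only: card_eq_sum)
  qed
  also have "\<dots> = (\<Sum>j\<in>?S. 1)"
    unfolding T by (intro sum.group) auto
  finally show ?thesis by simp
qed

lemma mat_trace_diag: "mat_trace (U * diag_of n m * mat_adjoint U) = (\<Sum>j<n. of_real (m j))"
proof -
  have "mat_trace (U * diag_of n m * mat_adjoint U) = mat_trace (mat_adjoint U * (U * diag_of n m))"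
    using U by (intro mat_trace_comm[of _ n n]) auto
  also have "mat_adjoint U * (U * diag_of n m) = mat_adjoint U * U * diag_of n m"
    using U by (simp add: assoc_mult_mat[of _ n n _ n _ n])
  also have "\<dots> = diag_of n m" by (simp add: UU left_mult_one_mat[of _ n n])
  finally show ?thesis by (simp add: mat_trace_def diag_of_def)
qed

lemma conj_diag_mult:
  "(U * diag_of n a * mat_adjoint U) * (U * diag_of n b * mat_adjoint U) =
     U * diag_of n (\<lambda>i. a i * b i) * mat_adjoint U"
proof -
  note assoc = assoc_mult_mat[of _ n n _ n _ n]
  have U': "mat_adjoint U \<in> carrier_mat n n" using U by simp
  have "diag_of n a * diag_of n b = diag_of n (\<lambda>i. a i * b i)"
  proof (rule eq_matI)
    fix i j assume "i < dim_row (diag_of n (\<lambda>i. a i * b i))" "j < dim_col (diag_of n (\<lambda>i. a i * b i))"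
    then have ij: "i < n" "j < n" by auto
    then have "(diag_of n a * diag_of n b) $$ (i, j) =
        (\<Sum>k<n. (if i = k then of_real (a i) else 0) * (if k = j then of_real (b k) else 0))"
      by (simp add: scalar_prod_def lessThan_atLeast0 diag_of_def)
    also have "\<dots> = (\<Sum>k<n. if k = i then (if i = j then of_real (a i * b i) else 0) else 0)"
      by (intro sum.cong refl) auto
    finally show "(diag_of n a * diag_of n b) $$ (i, j) = diag_of n (\<lambda>i. a i * b i) $$ (i, j)"
      using ij by (simp add: diag_of_def)
  qed auto
  moreover have "(U * diag_of n a * mat_adjoint U) * (U * diag_of n b * mat_adjoint U) =
      U * (diag_of n a * ((mat_adjoint U * U) * diag_of n b)) * mat_adjoint U"
    using U U' by (simp add: assoc mult_carrier_mat[of _ n n _ n])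
  ultimately show ?thesis by (simp add: UU left_mult_one_mat[of _ n n])
qed

lemma moments:
  "mat_trace A = (\<Sum>j<n. of_real (l j))"
  "mat_trace (A * A) = (\<Sum>j<n. of_real (l j ^ 2))"
  "mat_trace (A * A * A) = (\<Sum>j<n. of_real (l j ^ 3))"
  "mat_trace (A * A * (A * A)) = (\<Sum>j<n. of_real (l j ^ 4))"
  unfolding A_eq conj_diag_mult mat_trace_diag
  by (simp_all only: power2_eq_square power3_eq_cube power4_eq_xxxx mult.assoc)

section \<open>The Hermitian form in coordinates with respect to the eigenbasis\<close>

lemma quadratic_form:
  "(\<Sum>i<n. \<Sum>k<n. cnj (x i) * A $$ (i, k) * x k) =
     of_real (\<Sum>j<n. l j * (cmod (\<Sum>i<n. cnj (U $$ (i, j)) * x i))\<^sup>2)"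
proof -
  define z where "z j = (\<Sum>i<n. cnj (U $$ (i, j)) * x i)" for j
  have "(\<Sum>i<n. \<Sum>k<n. cnj (x i) * A $$ (i, k) * x k) =
      (\<Sum>i<n. \<Sum>k<n. \<Sum>j<n. of_real (l j) * ((cnj (x i) * U $$ (i, j)) * (cnj (U $$ (k, j)) * x k)))"
    
    by (intro sum.cong refl, simp only: A_entry lessThan_iff sum_distrib_left sum_distrib_right)
      (intro sum.cong refl, simp only: mult_ac)
  also have "\<dots> = (\<Sum>i<n. \<Sum>j<n. \<Sum>k<n. of_real (l j) * ((cnj (x i) * U $$ (i, j)) * (cnj (U $$ (k, j)) * x k)))"
    by (intro sum.cong refl sum.swap)
  also have "\<dots> = (\<Sum>j<n. \<Sum>i<n. \<Sum>k<n. of_real (l j) * ((cnj (x i) * U $$ (i, j)) * (cnj (U $$ (k, j)) * x k)))"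
    by (rule sum.swap)
  also have "\<dots> = (\<Sum>j<n. of_real (l j) * ((\<Sum>i<n. cnj (x i) * U $$ (i, j)) * z j))"
    by (intro sum.cong refl) (simp only: sum_distrib_left[symmetric] sum_distrib_right[symmetric] z_def)
  also have "\<dots> = (\<Sum>j<n. of_real (l j * (cmod (z j))\<^sup>2))"
  proof (intro sum.cong refl)
    fix j
    have "(\<Sum>i<n. cnj (x i) * U $$ (i, j)) = cnj (z j)" by (simp add: z_def mult.commute)
    then show "of_real (l j) * ((\<Sum>i<n. cnj (x i) * U $$ (i, j)) * z j) = complex_of_real (l j * (cmod (z j))\<^sup>2)"
      using complex_norm_square[of "z j"] by (simp add: mult.commute)
  qed
  finally show ?thesis by (simp add: z_def)
qed

lemma column_expansion:
  assumes "i < n"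
  shows "x i = (\<Sum>j<n. U $$ (i, j) * (\<Sum>k<n. cnj (U $$ (k, j)) * x k))"
proof -
  have "(\<Sum>j<n. U $$ (i, j) * (\<Sum>k<n. cnj (U $$ (k, j)) * x k)) =
      (\<Sum>k<n. \<Sum>j<n. U $$ (i, j) * cnj (U $$ (k, j)) * x k)"
    unfolding sum_distrib_left by (subst sum.swap) (simp add: mult.assoc)
  also have "\<dots> = (\<Sum>k<n. if k = i then x i else 0)"
    using assms by (intro sum.cong refl) (simp add: sum_distrib_right[symmetric] orthonormal_rows)
  finally show ?thesis using assms by simp
qed

text \<open>The inertia argument: if the span of the vectors \<open>w s\<close> had larger dimension
  than there are nonnegative eigenvalues, it would contain a nonzero vector orthogonal to all
  eigenvectors of those eigenvalues, and there the form is negative.\<close>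

lemma nonneg_subspace_card_le:
  assumes X: "finite X"
    and nonneg: "\<And>c. 0 \<le> Re (\<Sum>i<n. \<Sum>k<n. cnj (\<Sum>s\<in>X. c s * w s i) * A $$ (i, k) * (\<Sum>s\<in>X. c s * w s k))"
    and indep: "\<And>c s. (\<And>i. i < n \<Longrightarrow> (\<Sum>s\<in>X. c s * w s i) = 0) \<Longrightarrow> s \<in> X \<Longrightarrow> c s = 0"
  shows "card X \<le> num_nonneg_eigenvalues A"
proof (rule ccontr)
  let ?Y = "{j. j < n \<and> 0 \<le> l j}"
  let ?ip = "\<lambda>x j. \<Sum>i<n. cnj (U $$ (i, j)) * x i"
  assume "\<not> ?thesis"
  then have "card ?Y < card X" by (simp add: num_nonneg_eigenvalues_eq)
  then obtain c where c: "\<exists>s\<in>X. c s \<noteq> 0"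
    and orth: "\<And>j. j \<in> ?Y \<Longrightarrow> (\<Sum>s\<in>X. c s * ?ip (w s) j) = 0"
    using underdetermined_system[of ?Y X "\<lambda>s j. ?ip (w s) j"] X by auto
  define x where "x i = (\<Sum>s\<in>X. c s * w s i)" for i
  have "?ip x j = (\<Sum>s\<in>X. c s * ?ip (w s) j)" for j
    unfolding x_def sum_distrib_left by (subst sum.swap) (simp add: mult_ac)
  then have zero: "?ip x j = 0" if "j < n" "0 \<le> l j" for j using orth that by simp
  have term_le: "l j * (cmod (?ip x j))\<^sup>2 \<le> 0" if "j < n" for j
    using zero[OF that] by (cases "0 \<le> l j") (auto simp: mult_nonpos_nonneg)
  have "0 \<le> (\<Sum>j<n. l j * (cmod (?ip x j))\<^sup>2)"
    using nonneg[of c, folded x_def] unfolding quadratic_form by simp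
  moreover have "(\<Sum>j<n. l j * (cmod (?ip x j))\<^sup>2) \<le> 0"
    using term_le by (intro sum_nonpos) auto
  ultimately have "(\<Sum>j<n. - (l j * (cmod (?ip x j))\<^sup>2)) = 0" by (simp add: sum_negf)
  then have all0: "l j * (cmod (?ip x j))\<^sup>2 = 0" if "j < n" for j
    using term_le that by (subst (asm) sum_nonneg_eq_0_iff) auto
  \<comment> \<open>For \<open>l j < 0\<close> the vanishing product forces the coordinate to be 0;
    the other coordinates are 0 by the choice of \<open>c\<close>.\<close>
  have "?ip x j = 0" if "j < n" for j
    using all0[OF that] zero[OF that] by (cases "l j = 0") auto
  then have "x i = 0" if "i < n" for i
    using column_expansion[OF that, of x] by simp
  then show False using indep[of c] c unfolding x_def by blast
qed

end

lemma hermitian_diagonalization_exists: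
  fixes A :: "complex mat"
  assumes "A \<in> carrier_mat n n" "mat_adjoint A = A"
  obtains U l where "hermitian_diagonalization n A U l"
  using hermitian_spectral[OF assms] by (auto simp: hermitian_diagonalization_def)

section \<open>Scaling symmetric weights to unit row sums\<close>

text \<open>A dual form of the Hall-type criterion for fractional perfect matchings. The set
  \<open>P\<close> of positive values is independent, and its neighbours have values at most
  \<open>- m\<close>, where \<open>m\<close> is the least positive value. Since \<open>P\<close> is
  no larger than \<open>Q\<close>, moving both by \<open>m\<close> towards 0 does not decrease the
  sum, and fewer values stay positive.\<close>

lemma sum_nonpos_of_neighbourhoods_large:
  fixes y :: "'a \<Rightarrow> real"
  assumes "finite T"
    and expand: "\<And>J. J \<subseteq> T \<Longrightarrow> J \<noteq> {} \<Longrightarrow> \<forall>i\<in>J. \<forall>j\<in>J. \<not> E i j \<Longrightarrow>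
      card J \<le> card {j \<in> T. \<exists>i\<in>J. E i j}"
    and edge: "\<And>i j. i \<in> T \<Longrightarrow> j \<in> T \<Longrightarrow> E i j \<Longrightarrow> y i + y j \<le> 0"
  shows "sum y T \<le> 0"
  using edge
proof (induction "card {j \<in> T. y j > 0}" arbitrary: y rule: less_induct)
  case less
  define P where "P = {j \<in> T. y j > 0}"
  have P: "finite P" "P \<subseteq> T" using assms(1) by (auto simp: P_def)
  show ?case
  proof (cases "P = {}")
    case True
    then show ?thesis by (intro sum_nonpos) (auto simp: P_def not_less)
  next
    case False
    define m where "m = Min (y ` P)"
    have m_le: "m \<le> y j" if "j \<in> P" for j using that P(1) by (simp add: m_def)
    have "m \<in> y ` P" unfolding m_def using P(1) False by (intro Min_in) auto
    then obtain p where p: "p \<in> P" "y p = m" by blast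
    have m: "m > 0" using p by (auto simp: P_def)
    define Q where "Q = {j \<in> T. y j \<le> - m}"
    \<comment> \<open>Moving all values towards 0 by \<open>m\<close>, but not past 0, keeps the edge condition.\<close>
    define v where "v j = (if y j > 0 then y j - m else if y j \<le> - m then y j + m else 0)" for j
    have Q: "finite Q" "Q \<subseteq> T" using assms(1) by (auto simp: Q_def)
    have indep: "\<forall>i\<in>P. \<forall>j\<in>P. \<not> E i j"
    proof (intro ballI notI)
      fix i j assume "i \<in> P" "j \<in> P" "E i j"
      then show False using less.prems[of i j] by (simp add: P_def)
    qed
    have "{j \<in> T. \<exists>i\<in>P. E i j} \<subseteq> Q"
    proof
      fix j assume "j \<in> {j \<in> T. \<exists>i\<in>P. E i j}"
      then obtain i where "j \<in> T" "i \<in> P" "E i j" by blast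
      then show "j \<in> Q" using less.prems[of i j] m_le[of i] P(2) by (auto simp: Q_def)
    qed
    then have PQ: "card P \<le> card Q"
      using expand[OF P(2) False indep] card_mono[OF Q(1)] order_trans by blast
    have "sum v T \<le> 0"
    proof (rule less.hyps)
      \<comment> \<open>The value at \<open>p\<close> drops to exactly 0 and no new value becomes
        positive, so the induction measure falls.\<close>
      have "{j \<in> T. v j > 0} \<subseteq> P - {p}"
        using m p by (auto simp: v_def P_def split: if_splits)
      then have "card {j \<in> T. v j > 0} \<le> card (P - {p})"
        using P(1) by (intro card_mono) auto
      also have "\<dots> < card P" using p P(1) by (intro card_Diff1_less)
      finally show "card {j \<in> T. v j > 0} < card {j \<in> T. y j > 0}" by (simp add: P_def)
    next
      fix i j assume ij: "i \<in> T" "j \<in> T" "E i j"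
      note s = less.prems[OF ij]
      have "y i > 0 \<Longrightarrow> m \<le> y i" "y j > 0 \<Longrightarrow> m \<le> y j"
        using m_le[of i] m_le[of j] ij by (auto simp: P_def)
      then show "v i + v j \<le> 0" using s m unfolding v_def by (smt (verit))
    qed
    \<comment> \<open>Equality holds on \<open>P\<close> and \<open>Q\<close>; the values strictly
      between \<open>- m\<close> and 0 are raised to 0.\<close>
    moreover have "sum y T \<le> (\<Sum>j\<in>T. v j + (if j \<in> P then m else 0) - (if j \<in> Q then m else 0))"
      using m by (intro sum_mono) (auto simp: v_def P_def Q_def)
    moreover have "(\<Sum>j\<in>T. v j + (if j \<in> P then m else 0) - (if j \<in> Q then m else 0)) =
        sum v T + m * (real (card P) - real (card Q))"
      using P(2) Q(2) assms(1)
      by (simp add: sum.distrib sum_subtractf sum.If_cases Int_absorb1 algebra_simps)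
    moreover have "m * (real (card P) - real (card Q)) \<le> 0"
      using m PQ by (intro mult_nonneg_nonpos) auto
    ultimately show ?thesis by linarith
  qed
qed

text \<open>The logarithm is dominated by a square root, so that the square of \<open>s\<close> is
  at most a constant times \<open>s\<close>. This removes \<open>s\<close> from its own
  bound.\<close>

lemma linear_bound_of_log_bound:
  fixes s n b C :: real
  assumes "b > 0" "C \<ge> 0" "n \<ge> 0" "s \<le> n * ln (max 1 (2 * (C + s) / b)) / 2"
  shows "s \<le> max 1 (n\<^sup>2 * (1 + 2 * C / b + 2 / b))"
proof (cases "s \<le> 1")
  case False
  define M where "M = max 1 (2 * (C + s) / b)"
  have M: "M \<ge> 1" by (simp add: M_def)
  have "ln M = 2 * ln (sqrt M)" using M by (simp add: ln_sqrt)
  also have "\<dots> \<le> 2 * sqrt M" using ln_bound[of "sqrt M"] M by simp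
  finally have "n * ln M \<le> n * (2 * sqrt M)" using assms(3) by (rule mult_left_mono)
  then have "s \<le> n * sqrt M" using assms(4) by (simp add: M_def)
  then have "s\<^sup>2 \<le> (n * sqrt M)\<^sup>2" using False by (intro power_mono) auto
  also have "\<dots> = n\<^sup>2 * M" using M by (simp add: power_mult_distrib)
  \<comment> \<open>\<open>M\<close> is affine in \<open>s\<close> up to the maximum with 1, and
    \<open>1 \<le> s\<close> absorbs the constant terms into multiples of \<open>s\<close>.\<close>
  also have "\<dots> \<le> n\<^sup>2 * (s * (1 + 2 * C / b + 2 / b))"
  proof (rule mult_left_mono)
    define p q where "p = 2 * C / b" and "q = 2 / b"
    have "1 \<le> s" "0 \<le> p" "0 \<le> q" using assms False by (auto simp: p_def q_def)
    moreover from this have "0 \<le> s * p" "1 * p \<le> s * p" "0 \<le> s * q" using mult_right_mono[of 1 s p] by auto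
    moreover have "s * (1 + p + q) = s + s * p + s * q" by (simp add: algebra_simps)
    ultimately have "max 1 (p + s * q) \<le> s * (1 + p + q)" by (intro max.boundedI) linarith+
    moreover have "2 * (C + s) / b = p + s * q"
      by (simp add: p_def q_def add_divide_distrib distrib_left mult.commute)
    ultimately show "M \<le> s * (1 + 2 * C / b + 2 / b)"
      by (simp add: M_def p_def q_def)
  qed simp
  finally have "s * s \<le> s * (n\<^sup>2 * (1 + 2 * C / b + 2 / b))"
    by (simp add: power2_eq_square mult_ac)
  then have "s \<le> n\<^sup>2 * (1 + 2 * C / b + 2 / b)" using False by simp
  then show ?thesis by simp
qed simp

text \<open>Tychonoff's theorem: the box is a product of compact intervals over the whole index
  type, and functions carry the product topology.\<close>

lemma compact_box: "compact {x :: 'a \<Rightarrow> real. \<forall>i. \<bar>x i\<bar> \<le> K}"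
proof -
  have "{x :: 'a \<Rightarrow> real. \<forall>i. \<bar>x i\<bar> \<le> K} = (\<Pi>\<^sub>E i\<in>UNIV. {- K..K})"
    by (auto simp: PiE_UNIV_domain Pi_def abs_le_iff minus_le_iff)
  moreover have "compactin (product_topology (\<lambda>i::'a. euclidean :: real topology) UNIV) (\<Pi>\<^sub>E i\<in>UNIV. {- K..K})"
    by (simp add: compactin_PiE)
  ultimately show ?thesis by (simp add: euclidean_product_topology)
qed

text \<open>The nonzero weights are the edges. Strictness in \<open>expand\<close> leaves room for
  deleting one vertex, which is how single coordinates are bounded in
  \<open>sublevel_bounded\<close>.\<close>

locale expanding_weights =
  fixes S :: "'a set" and B :: "'a \<Rightarrow> 'a \<Rightarrow> real"
  assumes finite_S: "finite S"
    and B_nonneg: "\<And>i j. B i j \<ge> 0"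
    and B_sym: "\<And>i j. B i j = B j i"
    and expand: "\<And>J. J \<subseteq> S \<Longrightarrow> J \<noteq> {} \<Longrightarrow> \<forall>i\<in>J. \<forall>j\<in>J. B i j = 0 \<Longrightarrow>
      card J < card {j \<in> S. \<exists>i\<in>J. B i j \<noteq> 0}"
begin

text \<open>A critical point \<open>x\<close> of this convex function is exactly a scaling with unit row sums; the
  expansion hypothesis makes the function coercive, so that a minimum exists.\<close>

definition potential :: "('a \<Rightarrow> real) \<Rightarrow> real" where
  "potential x = (\<Sum>i\<in>S. \<Sum>j\<in>S. B i j * exp (x i + x j)) / 2 - sum x S"

text \<open>On a sublevel set every edge satisfies \<open>x j + x k \<le> L\<close>, where
  \<open>L\<close> is logarithmic in the total \<open>s\<close>. Expansion of \<open>S\<close> then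
  bounds \<open>s\<close> from above, expansion of \<open>S - {k}\<close> bounds \<open>x k\<close>
  from below, and both together bound each coordinate from above.\<close>

lemma sublevel_bounded:
  assumes "C \<ge> 0"
  shows "\<exists>K. \<forall>x. potential x \<le> C \<longrightarrow> (\<forall>i\<in>S. \<bar>x i\<bar> \<le> K)"
proof -
  \<comment> \<open>A positive lower bound for the nonzero weights; the inserted 1 keeps the minimum
    defined when there are no edges.\<close>
  define b where "b = Min (insert 1 ((\<lambda>(i, j). B i j) ` {(i, j) \<in> S \<times> S. B i j \<noteq> 0}))"
  have fin: "finite (insert 1 ((\<lambda>(i, j). B i j) ` {(i, j) \<in> S \<times> S. B i j \<noteq> 0}))"
    using finite_S by (auto intro: finite_subset[of _ "S \<times> S"])
  have "b \<in> insert 1 ((\<lambda>(i, j). B i j) ` {(i, j) \<in> S \<times> S. B i j \<noteq> 0})"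
    unfolding b_def using fin by (intro Min_in) auto
  then consider "b = 1" | i j where "B i j \<noteq> 0" "b = B i j" by auto
  then have b: "b > 0" by cases (use B_nonneg order.strict_iff_order[of 0] in auto)
  have b_le: "b \<le> B i j" if "i \<in> S" "j \<in> S" "B i j \<noteq> 0" for i j
    unfolding b_def using fin that by (intro Min_le) auto
  define N where "N = real (card S)"
  define K1 where "K1 = max 1 (N\<^sup>2 * (1 + 2 * C / b + 2 / b))"
  define L1 where "L1 = ln (max 1 (2 * (C + K1) / b))"
  define K2 where "K2 = C + N * L1"
  have L1: "L1 \<ge> 0" by (simp add: L1_def)
  have N: "N \<ge> 0" by (simp add: N_def)
  have K2: "K2 \<ge> 0" using assms L1 N by (simp add: K2_def)
  have K1: "K1 \<ge> 1" by (simp add: K1_def)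
  have "\<bar>x i\<bar> \<le> K1 + N * K2 + K2" if x: "potential x \<le> C" and i: "i \<in> S" for x i
  proof -
    define s where "s = sum x S"
    \<comment> \<open>A single summand of the double sum is at most \<open>2 * (C + s)\<close> and
      an edge has weight at least \<open>b\<close>. Shifting by \<open>L / 2\<close> normalises the
      edge condition to \<open>y j + y k \<le> 0\<close>, and the maximum with 1 ensures
      \<open>L \<ge> 0\<close>.\<close>
    define L where "L = ln (max 1 (2 * (C + s) / b))"
    define y where "y j = x j - L / 2" for j
    have L: "L \<ge> 0" by (simp add: L_def)
    have total: "(\<Sum>i\<in>S. \<Sum>j\<in>S. B i j * exp (x i + x j)) \<le> 2 * (C + s)"
      using x by (simp add: potential_def s_def)
    have "0 \<le> (\<Sum>i\<in>S. \<Sum>j\<in>S. B i j * exp (x i + x j))"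
      using B_nonneg by (intro sum_nonneg) auto
    from order_trans[OF this total] have s_lower: "s \<ge> - C" by simp
    have edge: "y j + y k \<le> 0" if jk: "j \<in> S" "k \<in> S" "B j k \<noteq> 0" for j k
    proof -
      have "b * exp (x j + x k) \<le> B j k * exp (x j + x k)"
        using b_le[OF jk] by simp
      also have "\<dots> \<le> (\<Sum>k\<in>S. B j k * exp (x j + x k))"
        using jk B_nonneg finite_S by (intro member_le_sum) auto
      also have "\<dots> \<le> (\<Sum>i\<in>S. \<Sum>j\<in>S. B i j * exp (x i + x j))"
        using jk B_nonneg finite_S
        by (intro member_le_sum[where f = "\<lambda>i. \<Sum>j\<in>S. B i j * exp (x i + x j)"] sum_nonneg) auto
      finally have "exp (x j + x k) \<le> 2 * (C + s) / b"
        using total b by (simp add: field_simps)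
      then have "ln (exp (x j + x k)) \<le> L"
        unfolding L_def by (subst ln_le_cancel_iff) auto
      then show ?thesis by (simp add: y_def)
    qed
    have sum_y: "sum y T = sum x T - real (card T) * L / 2" for T
      by (simp add: y_def sum_subtractf)
    have "sum y S \<le> 0"
    proof (rule sum_nonpos_of_neighbourhoods_large[where E = "\<lambda>i j. B i j \<noteq> 0", OF finite_S])
      fix J assume "J \<subseteq> S" "J \<noteq> {}" "\<forall>i\<in>J. \<forall>j\<in>J. \<not> B i j \<noteq> 0"
      then show "card J \<le> card {j \<in> S. \<exists>i\<in>J. B i j \<noteq> 0}" using expand[of J] by auto
    qed (use edge in auto)
    then have "s \<le> N * L / 2" by (simp add: sum_y s_def N_def)
    then have sK1: "s \<le> K1"
      unfolding K1_def L_def by (intro linear_bound_of_log_bound b assms N)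
    then have "max 1 (2 * (C + s) / b) \<le> max 1 (2 * (C + K1) / b)"
      using b by (intro max.mono) (auto simp: divide_right_mono)
    then have LL1: "L \<le> L1" unfolding L_def L1_def by (subst ln_le_cancel_iff) auto
    have lower: "x k \<ge> - K2" if k: "k \<in> S" for k
    proof -
      have "sum y (S - {k}) \<le> 0"
      proof (rule sum_nonpos_of_neighbourhoods_large[where E = "\<lambda>i j. B i j \<noteq> 0"])
        fix J assume J: "J \<subseteq> S - {k}" "J \<noteq> {}" "\<forall>i\<in>J. \<forall>j\<in>J. \<not> B i j \<noteq> 0"
        let ?M = "{j \<in> S. \<exists>i\<in>J. B i j \<noteq> 0}"
        \<comment> \<open>Deleting \<open>k\<close> loses at most one neighbour of \<open>J\<close>,
          for which the strict inequality compensates.\<close>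
        have "card J < card ?M" using J expand[of J] by auto
        also have "\<dots> \<le> card (?M - {k}) + 1"
          using finite_S by (auto simp: card_Diff_singleton_if)
        also have "?M - {k} = {j \<in> S - {k}. \<exists>i\<in>J. B i j \<noteq> 0}" by auto
        finally show "card J \<le> card {j \<in> S - {k}. \<exists>i\<in>J. B i j \<noteq> 0}" by simp
      qed (use finite_S edge in auto)
      then have "s - x k \<le> real (card (S - {k})) * L / 2"
        using k finite_S by (simp add: sum_y s_def sum_diff1)
      also have "\<dots> \<le> N * L1"
      proof -
        have "real (card (S - {k})) \<le> N" using finite_S by (simp add: N_def card_Diff1_le)
        then have "real (card (S - {k})) * L \<le> N * L1" using LL1 L N by (intro mult_mono) auto
        moreover have "0 \<le> N * L1" using N L1 by simp
        ultimately show ?thesis by linarith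
      qed
      finally show ?thesis using s_lower by (simp add: K2_def)
    qed
    have "- (N * K2) \<le> (\<Sum>k\<in>S - {i}. - K2)"
      using K2 finite_S by (simp add: N_def mult_right_mono card_Diff1_le)
    also have "\<dots> \<le> sum x (S - {i})" using lower by (intro sum_mono) auto
    also have "\<dots> = s - x i" using i finite_S by (simp add: s_def sum_diff1)
    finally have "x i \<le> K1 + N * K2" using sK1 by linarith
    moreover have "0 \<le> N * K2" using N K2 by simp
    ultimately show ?thesis using lower[OF i] K2 K1 by (simp add: abs_le_iff)
  qed
  then show ?thesis by blast
qed

lemma continuous_on_potential: "continuous_on X potential"
  unfolding potential_def
proof -
  have c: "continuous_on X (\<lambda>x. x i)" for i :: 'a
    by (rule continuous_on_subset[OF continuous_on_product_coordinates]) simp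
  show "continuous_on X (\<lambda>x. (\<Sum>i\<in>S. \<Sum>j\<in>S. B i j * exp (x i + x j)) / 2 - sum x S)"
    by (intro continuous_intros c) auto
qed

theorem scaling_exists: "\<exists>x. \<forall>i\<in>S. (\<Sum>j\<in>S. B i j * exp (x i + x j)) = 1"
proof -
  have "potential (\<lambda>_. 0) \<ge> 0"
    using B_nonneg by (auto simp: potential_def intro!: sum_nonneg)
  then obtain K where K: "\<And>x i. potential x \<le> potential (\<lambda>_. 0) \<Longrightarrow> i \<in> S \<Longrightarrow> \<bar>x i\<bar> \<le> K"
    using sublevel_bounded by meson
  \<comment> \<open>A minimiser on the box lies in the sublevel set of 0, so on \<open>S\<close> its
    coordinates are at most \<open>K\<close> in absolute value. The margin 1 lets each of them move
    freely; the absolute value of \<open>K\<close> guarantees that 0 is in the box.\<close>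
  define box where "box = {x :: 'a \<Rightarrow> real. \<forall>i. \<bar>x i\<bar> \<le> \<bar>K\<bar> + 1}"
  have zero: "(\<lambda>_. 0) \<in> box" by (simp add: box_def)
  have "\<exists>x\<in>box. \<forall>z\<in>box. potential x \<le> potential z"
    using zero by (intro continuous_attains_inf continuous_on_potential)
      (auto simp only: box_def compact_box)
  then obtain x where x: "x \<in> box" and min: "\<And>z. z \<in> box \<Longrightarrow> potential x \<le> potential z"
    by blast
  have "(\<Sum>j\<in>S. B i j * exp (x i + x j)) = 1" if i: "i \<in> S" for i
  proof -
    define g where "g t = potential (x(i := t))" for t
    let ?D = "(\<Sum>a\<in>S. \<Sum>b\<in>S. B a b * (exp (x a + x b) * ((if a = i then 1 else 0) + (if b = i then 1 else 0)))) / 2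
      - (\<Sum>a\<in>S. if a = i then 1 else 0)"
    have coord: "((\<lambda>t. (x(i := t)) a) has_real_derivative (if a = i then 1 else 0)) (at t)" for a t
      by (cases "a = i") auto
    have summand: "((\<lambda>t. B a b * exp ((x(i := t)) a + (x(i := t)) b)) has_real_derivative
        B a b * (exp (x a + x b) * ((if a = i then 1 else 0) + (if b = i then 1 else 0)))) (at (x i))" for a b
      using DERIV_cmult[OF DERIV_chain2[OF DERIV_exp DERIV_add[OF coord[of a "x i"] coord[of b "x i"]]], of "B a b"]
      by (simp only: fun_upd_triv)
    have "(g has_real_derivative ?D) (at (x i))"
      unfolding g_def potential_def
      by (intro DERIV_diff DERIV_cdivide DERIV_sum summand coord)
    moreover have "\<forall>t. \<bar>x i - t\<bar> < 1 \<longrightarrow> g (x i) \<le> g t"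
    proof (intro allI impI)
      fix t assume "\<bar>x i - t\<bar> < 1"
      moreover have "\<bar>x i\<bar> \<le> K" using K[OF min[OF zero] i] .
      ultimately have "x(i := t) \<in> box" using x by (auto simp: box_def)
      then show "g (x i) \<le> g t" using min by (simp add: g_def)
    qed
    ultimately have "?D = 0" using DERIV_local_min[of g ?D "x i" 1] by auto
    \<comment> \<open>Row \<open>i\<close> and column \<open>i\<close> contribute equally by
      symmetry of \<open>B\<close>, which cancels the factor 1/2 in
      \<open>potential\<close>.\<close>
    moreover have "(\<Sum>a\<in>S. \<Sum>b\<in>S. B a b * (exp (x a + x b) * ((if a = i then 1 else 0) + (if b = i then 1 else 0)))) =
       2 * (\<Sum>j\<in>S. B i j * exp (x i + x j))"
    proof -
      have "(\<Sum>a\<in>S. \<Sum>b\<in>S. B a b * (exp (x a + x b) * ((if a = i then 1 else 0) + (if b = i then 1 else 0)))) =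
         (\<Sum>a\<in>S. if a = i then \<Sum>b\<in>S. B a b * exp (x a + x b) else 0) +
         (\<Sum>a\<in>S. \<Sum>b\<in>S. if b = i then B a b * exp (x a + x b) else 0)"
        unfolding sum.distrib[symmetric]
      proof (intro sum.cong refl)
        fix a
        have "(if a = i then \<Sum>b\<in>S. B a b * exp (x a + x b) else 0) =
            (\<Sum>b\<in>S. if a = i then B a b * exp (x a + x b) else 0)" by simp
        moreover have "B a b * (exp (x a + x b) * ((if a = i then 1 else 0) + (if b = i then 1 else 0))) =
            (if a = i then B a b * exp (x a + x b) else 0) + (if b = i then B a b * exp (x a + x b) else 0)" for b
          by simp
        ultimately show "(\<Sum>b\<in>S. B a b * (exp (x a + x b) * ((if a = i then 1 else 0) + (if b = i then 1 else 0)))) =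
            (if a = i then \<Sum>b\<in>S. B a b * exp (x a + x b) else 0) +
            (\<Sum>b\<in>S. if b = i then B a b * exp (x a + x b) else 0)"
          by (simp only: sum.distrib)
      qed
      also have "\<dots> = (\<Sum>j\<in>S. B i j * exp (x i + x j)) + (\<Sum>j\<in>S. B j i * exp (x j + x i))"
        using i finite_S by simp
      also have "(\<Sum>j\<in>S. B j i * exp (x j + x i)) = (\<Sum>j\<in>S. B i j * exp (x i + x j))"
        by (intro sum.cong refl) (metis B_sym add.commute)
      finally show ?thesis by simp
    qed
    ultimately show ?thesis using i finite_S by simp
  qed
  then show ?thesis by blast
qed

end

section \<open>Moments of the spectrum\<close>

text \<open>Optimal quartic minorants of the indicator function of the positive reals for the moment
  problems at hand; the first one has no cubic term because triangles are allowed there. Each has a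
  double zero at \<open>-1\<close>, a zero at 0, and touches its bound at a positive point, namely at
  \<open>(1 + sqrt 3) / 2\<close> and at 1.\<close>

lemma quartic_le_C4:
  fixes y :: real
  shows "- (y ^ 4) + 3 * y\<^sup>2 + 2 * y \<le> (if y > 0 then 9 / 4 + 3 * sqrt 3 / 2 else 0)"
proof (cases "y > 0")
  case True
  define s where "s = sqrt (3 :: real)"
  define x where "x = (1 + s) / 2"
  have s: "s * s = 3" "s \<ge> 0" by (simp_all add: s_def)
  have x: "x * x = 1 + s / 2" using s by (simp add: x_def field_simps)
  have xs: "x * s = x + 1" using s by (simp add: x_def field_simps)
  have "(y - x)\<^sup>2 * (y\<^sup>2 + 2 * x * y + 3 * s / 2) =
      y ^ 4 + (3 * s / 2 - 3 * (x * x)) * y\<^sup>2 + 2 * x * (x * x) * y - 3 * (x * s) * y + 3 * s / 2 * (x * x)"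
    by (simp add: algebra_simps power2_eq_square power4_eq_xxxx)
  also have "\<dots> = y ^ 4 - 3 * y\<^sup>2 - 2 * y + (9 / 4 + 3 * s / 2)"
    unfolding xs x using s xs by (simp add: algebra_simps)
  finally have "y ^ 4 - 3 * y\<^sup>2 - 2 * y + (9 / 4 + 3 * s / 2) = (y - x)\<^sup>2 * (y\<^sup>2 + 2 * x * y + 3 * s / 2)" ..
  also have "\<dots> \<ge> 0"
    using True s by (intro mult_nonneg_nonneg add_nonneg_nonneg) (auto simp: x_def)
  finally show ?thesis using True by (simp add: s_def)
next
  case False
  have "- (y ^ 4) + 3 * y\<^sup>2 + 2 * y = y * ((y + 1)\<^sup>2 * (2 - y))"
    by (simp add: algebra_simps power2_eq_square power4_eq_xxxx)
  also have "\<dots> \<le> 0" using False by (intro mult_nonpos_nonneg mult_nonneg_nonneg) auto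
  finally show ?thesis using False by simp
qed

lemma quartic_le_girth5:
  fixes y :: real
  shows "3 / 4 * y + y\<^sup>2 - y ^ 3 / 4 - y ^ 4 / 2 \<le> (if y > 0 then 1 else 0)"
proof (cases "y > 0")
  case True
  have "1 - (3 / 4 * y + y\<^sup>2 - y ^ 3 / 4 - y ^ 4 / 2) = (y - 1)\<^sup>2 * (y\<^sup>2 / 2 + 5 / 4 * y + 1)"
    by (simp add: field_simps power2_eq_square power3_eq_cube power4_eq_xxxx)
  also have "\<dots> \<ge> 0" using True by (intro mult_nonneg_nonneg add_nonneg_nonneg) auto
  finally show ?thesis using True by simp
next
  case False
  have "3 / 4 * y + y\<^sup>2 - y ^ 3 / 4 - y ^ 4 / 2 = y * ((y + 1)\<^sup>2 * (3 / 4 - y / 2))"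
    by (simp add: field_simps power2_eq_square power3_eq_cube power4_eq_xxxx)
  also have "\<dots> \<le> 0" using False by (intro mult_nonpos_nonneg mult_nonneg_nonneg) auto
  finally show ?thesis using False by simp
qed

text \<open>Sum \<open>quartic_le_C4\<close> at \<open>y = t * l j\<close>. The moments give at
  least \<open>(3 * t^2 - 2 * t^4) * r\<close>, which is largest at \<open>t = sqrt 3 / 2\<close>
  with value \<open>9 / 8 * r\<close>; division by the bound \<open>M\<close> of the quartic yields
  the constant.\<close>

lemma card_positive_ge_C4:
  fixes l :: "nat \<Rightarrow> real"
  assumes "(\<Sum>j<n. l j) = 0" "(\<Sum>j<n. l j ^ 2) = r" "(\<Sum>j<n. l j ^ 4) \<le> 2 * r"
  shows "(sqrt 3 - 3 / 2) * r \<le> real (card {j. j < n \<and> l j > 0})"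
proof -
  define M :: real where "M = 9 / 4 + 3 * sqrt 3 / 2"
  have M: "M > 0" by (simp add: M_def add_pos_pos)
  have "- (9 / 16) * l j ^ 4 + 9 / 4 * l j ^ 2 + sqrt 3 * l j \<le> (if l j > 0 then M else 0)" for j
  proof -
    define y where "y = l j * (sqrt 3 / 2)"
    have y2: "y\<^sup>2 = 3 / 4 * l j ^ 2" by (simp add: y_def power_mult_distrib power_divide)
    have y4: "y ^ 4 = 9 / 16 * l j ^ 4"
    proof -
      have "y ^ 4 = (y\<^sup>2)\<^sup>2" by (simp add: power2_eq_square power4_eq_xxxx)
      then show ?thesis unfolding y2 by (simp add: power2_eq_square power4_eq_xxxx)
    qed
    have y0: "y > 0 \<longleftrightarrow> l j > 0" by (simp add: y_def zero_less_mult_iff)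
    have "- (9 / 16) * l j ^ 4 + 9 / 4 * l j ^ 2 + sqrt 3 * l j = - (y ^ 4) + 3 * y\<^sup>2 + 2 * y"
      unfolding y2 y4 by (simp add: y_def)
    then show ?thesis using quartic_le_C4[of y] by (simp only: y0 M_def)
  qed
  then have "(\<Sum>j<n. - (9 / 16) * l j ^ 4 + 9 / 4 * l j ^ 2 + sqrt 3 * l j) \<le>
      (\<Sum>j<n. if l j > 0 then M else 0)"
    by (intro sum_mono)
  also have "\<dots> = real (card {j. j < n \<and> l j > 0}) * M"
    by (simp add: sum.If_cases Int_def)
  also have "(\<Sum>j<n. - (9 / 16) * l j ^ 4 + 9 / 4 * l j ^ 2 + sqrt 3 * l j) =
      - (9 / 16) * (\<Sum>j<n. l j ^ 4) + 9 / 4 * r + sqrt 3 * 0"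
    unfolding assms(1,2)[symmetric] by (simp only: sum.distrib sum_distrib_left)
  finally have "9 / 8 * r \<le> real (card {j. j < n \<and> l j > 0}) * M"
    using assms(3) by simp
  moreover have "(sqrt 3 - 3 / 2) * M = 9 / 8"
  proof -
    have "(t - 3 / 2) * (9 / 4 + 3 * t / 2) = 3 / 2 * (t * t) - 27 / 8" for t :: real
      by (simp add: field_simps)
    from this[of "sqrt 3"] show ?thesis by (simp add: M_def)
  qed
  moreover have "((sqrt 3 - 3 / 2) * r) * M = (sqrt 3 - 3 / 2) * M * r"
    by (simp only: mult_ac)
  ultimately have "((sqrt 3 - 3 / 2) * r) * M \<le> real (card {j. j < n \<and> l j > 0}) * M"
    by (simp only:)
  then show ?thesis using M by simp
qed

text \<open>Sum \<open>quartic_le_girth5\<close> at \<open>y = s * l j\<close>. The moments give at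
  least \<open>(s^2 - s^4) * r\<close>, which is largest at \<open>s = sqrt (1 / 2)\<close> with
  value \<open>r / 4\<close>.\<close>

lemma card_positive_ge_girth5:
  fixes l :: "nat \<Rightarrow> real"
  assumes "(\<Sum>j<n. l j) = 0" "(\<Sum>j<n. l j ^ 2) = r" "(\<Sum>j<n. l j ^ 3) = 0" "(\<Sum>j<n. l j ^ 4) \<le> 2 * r"
  shows "1 / 4 * r \<le> real (card {j. j < n \<and> l j > 0})"
proof -
  define s where "s = sqrt (1 / 2 :: real)"
  have s: "s > 0" "s\<^sup>2 = 1 / 2" by (simp_all add: s_def)
  have s4: "s ^ 4 = 1 / 4" using power_mult[of s 2 2] s(2) by (simp add: power_divide)
  have "3 / 4 * s * l j + 1 / 2 * l j ^ 2 - s ^ 3 / 4 * l j ^ 3 - 1 / 8 * l j ^ 4 \<le> (if l j > 0 then 1 else 0)" for j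
    using quartic_le_girth5[of "s * l j"] s s4 by (simp add: power_mult_distrib zero_less_mult_iff)
  then have "(\<Sum>j<n. 3 / 4 * s * l j + 1 / 2 * l j ^ 2 - s ^ 3 / 4 * l j ^ 3 - 1 / 8 * l j ^ 4) \<le>
      (\<Sum>j<n. if l j > 0 then 1 else 0)"
    by (intro sum_mono)
  also have "\<dots> = real (card {j. j < n \<and> l j > 0})"
    by (simp add: sum.If_cases Int_def)
  also have "(\<Sum>j<n. 3 / 4 * s * l j + 1 / 2 * l j ^ 2 - s ^ 3 / 4 * l j ^ 3 - 1 / 8 * l j ^ 4) =
      3 / 4 * s * (\<Sum>j<n. l j) + 1 / 2 * (\<Sum>j<n. l j ^ 2) - s ^ 3 / 4 * (\<Sum>j<n. l j ^ 3) - 1 / 8 * (\<Sum>j<n. l j ^ 4)"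
    by (simp only: sum.distrib sum_subtractf sum_distrib_left)
  finally show ?thesis using assms by simp
qed

section \<open>Trace moments of a Hermitian matrix whose rows in \<open>R\<close> have unit
  norm\<close>

lemma cmod_sum_single:
  assumes "finite X" "\<And>a b. a \<in> X \<Longrightarrow> b \<in> X \<Longrightarrow> f a \<noteq> 0 \<Longrightarrow> f b \<noteq> 0 \<Longrightarrow> a = b"
  shows "(cmod (sum f X))\<^sup>2 = (\<Sum>a\<in>X. (cmod (f a))\<^sup>2)"
proof (cases "\<exists>a\<in>X. f a \<noteq> 0")
  case True
  then obtain a where a: "a \<in> X" "f a \<noteq> 0" by blast
  then have zero: "f b = 0" if "b \<in> X - {a}" for b using assms(2) that by blast
  have "sum f X = f a" using sum.remove[OF assms(1) a(1), of f] zero by simp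
  moreover have "(\<Sum>b\<in>X. (cmod (f b))\<^sup>2) = (cmod (f a))\<^sup>2"
    using sum.remove[OF assms(1) a(1), of "\<lambda>b. (cmod (f b))\<^sup>2"] zero by simp
  ultimately show ?thesis by simp
qed simp

text \<open>\<open>M\<close> keeps the size of the whole matrix and vanishes outside \<open>R\<close>: the padding only adds zero
  eigenvalues, which are harmless since positive eigenvalues are counted.\<close>

locale doubly_stochastic_weights =
  fixes n :: nat and M :: "complex mat" and R :: "nat set"
  assumes M: "M \<in> carrier_mat n n" and herm: "mat_adjoint M = M"
    and R: "R \<subseteq> {..<n}"
    and row: "\<And>i. i < n \<Longrightarrow> (\<Sum>k<n. (cmod (M $$ (i, k)))\<^sup>2) = (if i \<in> R then 1 else 0)"
begin

lemma hermitian_entry: "i < n \<Longrightarrow> k < n \<Longrightarrow> M $$ (i, k) = cnj (M $$ (k, i))"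
  using arg_cong[OF herm, of "\<lambda>N. N $$ (i, k)"] M by simp

lemma sum_R: "(\<Sum>i<n. if i \<in> R then 1 else 0) = real (card R)"
  using R by (simp add: sum.If_cases Int_absorb1)

lemma square_entry: "i < n \<Longrightarrow> k < n \<Longrightarrow> (M * M) $$ (i, k) = (\<Sum>j<n. M $$ (i, j) * M $$ (j, k))"
  using M by (simp add: scalar_prod_def lessThan_atLeast0)

lemma square_diag:
  assumes "i < n"
  shows "(M * M) $$ (i, i) = of_real (if i \<in> R then 1 else 0)"
proof -
  have "M $$ (i, j) * M $$ (j, i) = of_real ((cmod (M $$ (i, j)))\<^sup>2)" if "j < n" for j
    using hermitian_entry[OF that assms] complex_norm_square[of "M $$ (i, j)"] by simp
  then have "(M * M) $$ (i, i) = (\<Sum>j<n. of_real ((cmod (M $$ (i, j)))\<^sup>2))"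
    unfolding square_entry[OF assms assms] by (intro sum.cong refl) auto
  also have "\<dots> = of_real (\<Sum>j<n. (cmod (M $$ (i, j)))\<^sup>2)" by simp
  finally show ?thesis by (simp only: row[OF assms])
qed

lemma trace_square: "mat_trace (M * M) = of_real (real (card R))"
proof -
  have "mat_trace (M * M) = (\<Sum>i<n. of_real (if i \<in> R then 1 else 0))"
    using M by (simp add: mat_trace_def square_diag del: index_mult_mat(1))
  also have "\<dots> = of_real (\<Sum>i<n. if i \<in> R then 1 else 0)" by simp
  finally show ?thesis by (simp only: sum_R)
qed

text \<open>The trace is the sum of the squared moduli of the entries of \<open>M * M\<close>. The
  diagonal contributes \<open>card R\<close>. Off the diagonal each entry is a single product by
  \<open>C4\<close>, and the squared moduli of all such products sum to at most
  \<open>card R\<close>, as rows and columns of squared moduli sum to at most 1.\<close>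

lemma trace_fourth_le:
  assumes C4: "\<And>i k a b. i < n \<Longrightarrow> k < n \<Longrightarrow> a < n \<Longrightarrow> b < n \<Longrightarrow> i \<noteq> k \<Longrightarrow>
    M $$ (i, a) \<noteq> 0 \<Longrightarrow> M $$ (a, k) \<noteq> 0 \<Longrightarrow> M $$ (i, b) \<noteq> 0 \<Longrightarrow> M $$ (b, k) \<noteq> 0 \<Longrightarrow> a = b"
  shows "Re (mat_trace (M * M * (M * M))) \<le> 2 * real (card R)"
proof -
  let ?m = "\<lambda>i k. (cmod (M $$ (i, k)))\<^sup>2"
  have MM: "M * M \<in> carrier_mat n n" using M by simp
  have sq_herm: "(M * M) $$ (i, k) * (M * M) $$ (k, i) = of_real ((cmod ((M * M) $$ (i, k)))\<^sup>2)"
    if "i < n" "k < n" for i k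
  proof -
    have "(M * M) $$ (k, i) = cnj ((M * M) $$ (i, k))"
      unfolding square_entry[OF that] square_entry[OF that(2,1)] cnj_sum
    proof (intro sum.cong refl)
      fix j assume "j \<in> {..<n}"
      then show "M $$ (k, j) * M $$ (j, i) = cnj (M $$ (i, j) * M $$ (j, k))"
        using hermitian_entry[of k j] hermitian_entry[of j i] that by (simp add: mult.commute)
    qed
    then show ?thesis using complex_norm_square[of "(M * M) $$ (i, k)"] by simp
  qed
  \<comment> \<open>The second sum is kept for \<open>k = i\<close> too: it is nonnegative there,
    and the total over all \<open>i\<close> and \<open>k\<close> then factors into row and column
    sums.\<close>
  have entry: "(cmod ((M * M) $$ (i, k)))\<^sup>2 \<le>
      (if k = i then if i \<in> R then 1 else 0 else 0) + (\<Sum>j<n. ?m i j * ?m j k)" if ik: "i < n" "k < n" for i k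
  proof (cases "k = i")
    case True
    have "0 \<le> (\<Sum>j<n. ?m i j * ?m j k)" by (intro sum_nonneg) auto
    moreover have "(cmod ((M * M) $$ (i, k)))\<^sup>2 \<le> (if i \<in> R then 1 else 0)"
      unfolding True square_diag[OF ik(1)] by simp
    ultimately show ?thesis using True by simp
  next
    case False
    have "(cmod ((M * M) $$ (i, k)))\<^sup>2 = (\<Sum>j<n. (cmod (M $$ (i, j) * M $$ (j, k)))\<^sup>2)"
      unfolding square_entry[OF ik] by (rule cmod_sum_single) (use C4[OF ik] False in auto)
    then show ?thesis using False by (simp add: norm_mult power_mult_distrib)
  qed
  have col: "(\<Sum>i<n. ?m i j) = (if j \<in> R then 1 else 0)" if "j < n" for j
  proof -
    have "(\<Sum>i<n. ?m i j) = (\<Sum>i<n. ?m j i)"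
    proof (intro sum.cong refl)
      fix i assume "i \<in> {..<n}"
      then show "?m i j = ?m j i" using hermitian_entry[of i j] that by simp
    qed
    then show ?thesis by (simp only: row[OF that])
  qed
  have "Re (mat_trace (M * M * (M * M))) = (\<Sum>i<n. \<Sum>k<n. (cmod ((M * M) $$ (i, k)))\<^sup>2)"
    unfolding mat_trace_mult[OF MM MM] by (simp add: sq_herm del: of_real_power index_mult_mat(1))
  also have "\<dots> \<le> (\<Sum>i<n. \<Sum>k<n. (if k = i then if i \<in> R then 1 else 0 else 0) + (\<Sum>j<n. ?m i j * ?m j k))"
    by (intro sum_mono entry) auto
  also have "\<dots> = (\<Sum>i<n. \<Sum>k<n. if k = i then if i \<in> R then 1 else 0 else 0) + (\<Sum>i<n. \<Sum>k<n. \<Sum>j<n. ?m i j * ?m j k)"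
    by (simp only: sum.distrib)
  also have "(\<Sum>i<n. \<Sum>k<n. if k = i then if i \<in> R then 1 else 0 else 0) = real (card R)"
    unfolding sum_R[symmetric] by (intro sum.cong refl) simp
  also have "(\<Sum>i<n. \<Sum>k<n. \<Sum>j<n. ?m i j * ?m j k) = (\<Sum>i<n. \<Sum>j<n. \<Sum>k<n. ?m i j * ?m j k)"
    by (intro sum.cong refl sum.swap)
  also have "\<dots> = (\<Sum>j<n. \<Sum>i<n. \<Sum>k<n. ?m i j * ?m j k)"
    by (rule sum.swap)
  also have "\<dots> = (\<Sum>j<n. (\<Sum>i<n. ?m i j) * (\<Sum>k<n. ?m j k))"
    by (simp only: sum_product)
  also have "\<dots> = (\<Sum>j<n. if j \<in> R then 1 else 0)"
    by (intro sum.cong refl) (simp add: col row)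
  finally show ?thesis by (simp only: sum_R)
qed

lemma trace_cube_zero:
  assumes "\<And>i j k. i < n \<Longrightarrow> j < n \<Longrightarrow> k < n \<Longrightarrow> M $$ (i, j) \<noteq> 0 \<Longrightarrow> M $$ (j, k) \<noteq> 0 \<Longrightarrow> M $$ (k, i) = 0"
  shows "mat_trace (M * M * M) = 0"
proof -
  have "mat_trace (M * M * M) = (\<Sum>i<n. \<Sum>k<n. (M * M) $$ (i, k) * M $$ (k, i))"
    by (rule mat_trace_mult) (use M in auto)
  also have "\<dots> = 0"
  proof (intro sum.neutral ballI)
    fix i k assume "i \<in> {..<n}" "k \<in> {..<n}"
    then have ik: "i < n" "k < n" by auto
    have "(M * M) $$ (i, k) * M $$ (k, i) = (\<Sum>j<n. M $$ (i, j) * M $$ (j, k) * M $$ (k, i))"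
      unfolding square_entry[OF ik] by (simp add: sum_distrib_right)
    also have "\<dots> = 0"
    proof (intro sum.neutral ballI)
      fix j assume "j \<in> {..<n}"
      then show "M $$ (i, j) * M $$ (j, k) * M $$ (k, i) = 0"
        using assms[OF ik(1) _ ik(2), of j] by auto
    qed
    finally show "(M * M) $$ (i, k) * M $$ (k, i) = 0" .
  qed
  finally show ?thesis .
qed

end

section \<open>Counting nonnegative eigenvalues\<close>

text \<open>The hypothesis \<open>scaled\<close> isolates the spectral estimate on \<open>R\<close>,
  the only place where the forbidden cycles enter. The bound \<open>\<beta> \<le> 1 / 2\<close> is
  what lets \<open>card I\<close> eigenvalues pay for up to \<open>2 * card I\<close>
  vertices.\<close>

lemma num_nonneg_eigenvalues_ge:
  fixes A :: "complex mat" and \<beta> :: real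
  assumes A: "A \<in> carrier_mat n n" and herm: "mat_adjoint A = A"
    and \<beta>: "0 \<le> \<beta>" "\<beta> \<le> 1 / 2"
    and scaled: "\<And>M R U l. doubly_stochastic_weights n M R \<Longrightarrow>
      (\<And>i k. i < n \<Longrightarrow> k < n \<Longrightarrow> A $$ (i, k) = 0 \<Longrightarrow> M $$ (i, k) = 0) \<Longrightarrow>
      hermitian_diagonalization n M U l \<Longrightarrow> \<beta> * real (card R) \<le> real (card {j. j < n \<and> l j > 0})"
  shows "\<beta> * real n \<le> real (num_nonneg_eigenvalues A)"
proof -
  have A_herm: "A $$ (i, k) = cnj (A $$ (k, i))" if "i < n" "k < n" for i k
    using arg_cong[OF herm, of "\<lambda>N. N $$ (i, k)"] A that by simp
  have A_sym: "A $$ (i, k) = 0 \<longleftrightarrow> A $$ (k, i) = 0" if "i < n" "k < n" for i k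
    using A_herm[OF that] by simp
  \<comment> \<open>Adjacency means a nonzero entry of \<open>A\<close>, so edges of weight 0 are
    ignored and \<open>B\<close> below is positive on every edge.\<close>
  define indep where "indep I \<longleftrightarrow> I \<subseteq> {..<n} \<and> (\<forall>i\<in>I. \<forall>j\<in>I. A $$ (i, j) = 0)" for I
  define N where "N I = {j. j < n \<and> (\<exists>i\<in>I. A $$ (i, j) \<noteq> 0)}" for I
  define F where "F = {I. indep I \<and> card (N I) \<le> card I}"
  have N_fin: "finite (N I)" for I by (simp add: N_def)
  have "F \<subseteq> Pow {..<n}" by (auto simp: F_def indep_def)
  then have "finite F" by (rule finite_subset) simp
  moreover have "{} \<in> F" by (auto simp: F_def indep_def N_def)
  ultimately have "Max (card ` F) \<in> card ` F" by (intro Max_in) auto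
  \<comment> \<open>Maximality of \<open>I\<close> forces expansion in the rest \<open>R\<close>: an independent set of \<open>R\<close> with too few
    neighbours in \<open>R\<close> could be added to \<open>I\<close>.\<close>
  then obtain I where I: "I \<in> F" and "card I = Max (card ` F)" by auto
  with \<open>finite F\<close> have I_max: "card J \<le> card I" if "J \<in> F" for J using that by simp
  have indep_I: "indep I" and card_NI: "card (N I) \<le> card I" using I by (auto simp: F_def)
  have I_sub: "I \<subseteq> {..<n}" and I_fin: "finite I"
    using indep_I by (auto simp: indep_def intro: finite_subset)
  define R where "R = {..<n} - I - N I"
  have R: "R \<subseteq> {..<n}" "finite R" by (auto simp: R_def)
  have IR0: "A $$ (i, k) = 0" "A $$ (k, i) = 0" if "i \<in> I" "k \<in> R" for i k
    using that A_sym[of i k] I_sub by (auto simp: R_def N_def)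
  have II0: "A $$ (i, k) = 0" if "i \<in> I" "k \<in> I" for i k
    using that indep_I by (auto simp: indep_def)
  define B where "B i j = (if i < n \<and> j < n then (cmod (A $$ (i, j)))\<^sup>2 else 0)" for i j
  interpret expanding_weights R B
  proof
    fix i j
    show "B i j \<ge> 0" by (simp add: B_def)
    show "B i j = B j i" using A_herm[of i j] by (simp add: B_def)
  next
    fix J assume J: "J \<subseteq> R" "J \<noteq> {}" "\<forall>i\<in>J. \<forall>j\<in>J. B i j = 0"
    have J_fin: "finite J" using J(1) R(2) by (rule finite_subset)
    have J_sub: "J \<subseteq> {..<n}" using J(1) R(1) by simp
    have J_indep: "A $$ (i, j) = 0" if "i \<in> J" "j \<in> J" for i j
    proof -
      have "i < n" "j < n" using that J_sub by auto
      moreover have "B i j = 0" using J(3) that by blast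
      ultimately show ?thesis by (simp add: B_def)
    qed
    let ?M = "{j \<in> R. \<exists>i\<in>J. B i j \<noteq> 0}"
    show "card J < card ?M"
    proof (rule ccontr)
      assume "\<not> ?thesis"
      then have le: "card ?M \<le> card J" by simp
      have "I \<inter> J = {}" using J(1) by (auto simp: R_def)
      then have card_IJ: "card (I \<union> J) = card I + card J"
        using I_fin J_fin by (simp add: card_Un_disjoint)
      have "N (I \<union> J) \<subseteq> N I \<union> ?M"
      proof
        fix j assume "j \<in> N (I \<union> J)"
        then obtain i where i: "i \<in> I \<union> J" "A $$ (i, j) \<noteq> 0" and j: "j < n" by (auto simp: N_def)
        show "j \<in> N I \<union> ?M"
        proof (cases "i \<in> I \<or> j \<in> N I")
          case True
          then show ?thesis using i j by (auto simp: N_def)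
        next
          case False
          then have "i \<in> J" using i by simp
          moreover have "j \<notin> I" using IR0(2)[of j i] i(2) \<open>i \<in> J\<close> J(1) by auto
          ultimately have "j \<in> R" using False j by (simp add: R_def)
          moreover have "B i j \<noteq> 0" using i(2) j \<open>i \<in> J\<close> J_sub by (auto simp: B_def)
          ultimately show ?thesis using \<open>i \<in> J\<close> by blast
        qed
      qed
      then have "card (N (I \<union> J)) \<le> card (N I \<union> ?M)"
        using N_fin R(2) by (intro card_mono) auto
      also have "\<dots> \<le> card (N I) + card ?M" by (rule card_Un_le)
      also have "\<dots> \<le> card (I \<union> J)" using card_NI le card_IJ by simp
      finally have "card (N (I \<union> J)) \<le> card (I \<union> J)" .
      moreover have "indep (I \<union> J)"
        unfolding indep_def using I_sub J_sub II0 J_indep IR0 J(1) by blast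
      ultimately have "I \<union> J \<in> F" by (simp add: F_def)
      from I_max[OF this] card_IJ have "card J = 0" by simp
      then show False using J(2) J_fin by simp
    qed
  qed (rule R(2))
  obtain x where x: "\<And>i. i \<in> R \<Longrightarrow> (\<Sum>j\<in>R. B i j * exp (x i + x j)) = 1"
    using scaling_exists by blast
  \<comment> \<open>The exponent is halved because \<open>B\<close> holds squared moduli: the square
    of \<open>D i * D k\<close> is \<open>exp (x i + x k)\<close>.\<close>
  define D where "D i = exp (x i / 2)" for i
  have D: "D i > 0" for i by (simp add: D_def)
  define M where "M = mat n n (\<lambda>(i, k). if i \<in> R \<and> k \<in> R then of_real (D i * D k) * A $$ (i, k) else 0)"
  have M_entry: "M $$ (i, k) = (if i \<in> R \<and> k \<in> R then of_real (D i * D k) * A $$ (i, k) else 0)"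
    if "i < n" "k < n" for i k
    using that by (simp add: M_def)
  have weights: "doubly_stochastic_weights n M R"
  proof
    show "M \<in> carrier_mat n n" by (simp add: M_def)
    show "R \<subseteq> {..<n}" by (rule R(1))
    show "mat_adjoint M = M"
    proof (rule eq_matI)
      fix i k assume "i < dim_row M" "k < dim_col M"
      then have ik: "i < n" "k < n" by (simp_all add: M_def)
      then have "mat_adjoint M $$ (i, k) = cnj (M $$ (k, i))" by (simp add: M_def)
      also have "\<dots> = M $$ (i, k)" using M_entry[OF ik] M_entry[OF ik(2,1)] A_herm[OF ik] by simp
      finally show "mat_adjoint M $$ (i, k) = M $$ (i, k)" .
    qed (simp_all add: M_def)
  next
    fix i assume i: "i < n"
    have entry: "(cmod (M $$ (i, k)))\<^sup>2 = (if i \<in> R then (if k \<in> R then B i k * exp (x i + x k) else 0) else 0)"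
      if "k < n" for k
    proof -
      have "(D i * D k)\<^sup>2 = exp (x i + x k)"
        by (simp add: D_def exp_add[symmetric] exp_double[symmetric] add_divide_distrib[symmetric])
      moreover have "cmod (of_real (D i * D k) * A $$ (i, k)) = (D i * D k) * cmod (A $$ (i, k))"
        using D[of i] D[of k] by (simp add: norm_mult)
      ultimately show ?thesis
        using i that by (simp add: M_entry B_def power_mult_distrib mult.commute del: of_real_mult)
    qed
    have "(\<Sum>k<n. (cmod (M $$ (i, k)))\<^sup>2) =
        (\<Sum>k<n. if i \<in> R then (if k \<in> R then B i k * exp (x i + x k) else 0) else 0)"
      by (intro sum.cong refl) (simp add: entry)
    also have "\<dots> = (if i \<in> R then 1 else 0)"
      using x[of i] R by (simp add: sum.If_cases Int_absorb1)
    finally show "(\<Sum>k<n. (cmod (M $$ (i, k)))\<^sup>2) = (if i \<in> R then 1 else 0)" .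
  qed
  then obtain V l where diag: "hermitian_diagonalization n M V l"
    using hermitian_diagonalization_exists[of M n] doubly_stochastic_weights.M doubly_stochastic_weights.herm
    by metis
  interpret M: hermitian_diagonalization n M V l by (rule diag)
  obtain U m where "hermitian_diagonalization n A U m"
    using hermitian_diagonalization_exists[OF A herm] by metis
  then interpret A: hermitian_diagonalization n A U m .
  define J where "J = {j. j < n \<and> l j > 0}"
  have J: "finite J" by (simp add: J_def)
  \<comment> \<open>Rows of \<open>M\<close> outside \<open>R\<close> are zero, so an eigenvector
    with nonzero eigenvalue is supported on \<open>R\<close>.\<close>
  have V0: "V $$ (k, j) = 0" if "k < n" "k \<notin> R" "j \<in> J" for k j
  proof -
    have "of_real (l j) * V $$ (k, j) = (\<Sum>i<n. M $$ (k, i) * V $$ (i, j))"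
      using that M.eigenvector_column[of k j] by (simp add: J_def)
    also have "\<dots> = 0" using that M_entry by (intro sum.neutral) auto
    finally show ?thesis using that by (simp add: J_def)
  qed
  \<comment> \<open>The form of \<open>A\<close> is nonnegative on the span of the unit vectors at \<open>I\<close> and the rescaled positive
    eigenvectors of \<open>M\<close>, because \<open>A\<close> vanishes on \<open>I\<close> and between \<open>I\<close> and \<open>R\<close>.\<close>
  define w where "w s k = (case s of Inl i \<Rightarrow> if k = i then 1 else 0 | Inr j \<Rightarrow> of_real (D k) * V $$ (k, j))"
    for s :: "nat + nat" and k
  define z where "z c k = (\<Sum>j\<in>J. c (Inr j :: nat + nat) * V $$ (k, j))" for c k
  define comb where "comb c k = (\<Sum>s\<in>I <+> J. c s * w s k)" for c k
  have comb: "comb c k = (if k \<in> I then c (Inl k) else 0) + of_real (D k) * z c k" for c k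
  proof -
    have "comb c k = (\<Sum>i\<in>I. if k = i then c (Inl i) else 0) + (\<Sum>j\<in>J. of_real (D k) * (c (Inr j) * V $$ (k, j)))"
      unfolding comb_def sum.Plus[OF I_fin J] comp_def w_def
      by (intro arg_cong2[of _ _ _ _ "(+)"] sum.cong refl) (auto simp: mult_ac)
    then show ?thesis using I_fin by (simp add: z_def sum_distrib_left)
  qed
  have z0: "z c k = 0" if "k < n" "k \<notin> R" for c k
    unfolding z_def using V0[OF that] by (intro sum.neutral) auto
  have comb_cases: "comb c k = (if k \<in> R then of_real (D k) * z c k else if k \<in> I then c (Inl k) else 0)"
    if "k < n" for c k
    using that z0[of k c] by (auto simp: comb R_def)
  have ip: "(\<Sum>i<n. cnj (V $$ (i, j)) * z c i) = (if j \<in> J then c (Inr j) else 0)" if "j < n" for c j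
  proof -
    have "(\<Sum>i<n. cnj (V $$ (i, j)) * z c i) = (\<Sum>k\<in>J. c (Inr k) * (\<Sum>i<n. cnj (V $$ (i, j)) * V $$ (i, k)))"
      unfolding z_def sum_distrib_left by (subst sum.swap) (simp add: mult_ac)
    also have "\<dots> = (\<Sum>k\<in>J. if k = j then c (Inr j) else 0)"
      using that by (intro sum.cong refl) (auto simp: M.orthonormal_columns J_def)
    finally show ?thesis using J by simp
  qed
  have "card (I <+> J) \<le> num_nonneg_eigenvalues A"
  proof (rule A.nonneg_subspace_card_le[of _ w])
    show "finite (I <+> J)" using I_fin J by simp
  next
    fix c
    \<comment> \<open>\<open>comb c\<close> vanishes outside \<open>I\<close> and \<open>R\<close>.
      Of the remaining entries of \<open>A\<close> only those with both indices in \<open>R\<close>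
      can be nonzero, and there the factors \<open>D\<close> turn \<open>A\<close> into
      \<open>M\<close>.\<close>
    have entry: "cnj (comb c i) * A $$ (i, k) * comb c k = cnj (z c i) * M $$ (i, k) * z c k" if "i < n" "k < n" for i k
      using that z0[of i c] z0[of k c] II0[of i k] IR0[of i k] IR0[of k i]
      by (auto simp: comb_cases M_entry)
    have "(\<Sum>i<n. \<Sum>k<n. cnj (comb c i) * A $$ (i, k) * comb c k) =
        (\<Sum>i<n. \<Sum>k<n. cnj (z c i) * M $$ (i, k) * z c k)"
      by (intro sum.cong refl entry) auto
    also have "\<dots> = of_real (\<Sum>j<n. l j * (cmod (if j \<in> J then c (Inr j) else 0))\<^sup>2)"
      unfolding M.quadratic_form by (intro arg_cong[of _ _ of_real] sum.cong refl) (simp add: ip)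
    finally have "Re (\<Sum>i<n. \<Sum>k<n. cnj (comb c i) * A $$ (i, k) * comb c k) =
        (\<Sum>j<n. l j * (cmod (if j \<in> J then c (Inr j) else 0))\<^sup>2)" by simp
    also have "\<dots> \<ge> 0" by (intro sum_nonneg) (auto simp: J_def)
    finally show "0 \<le> Re (\<Sum>i<n. \<Sum>k<n. cnj (\<Sum>s\<in>I <+> J. c s * w s i) * A $$ (i, k) * (\<Sum>s\<in>I <+> J. c s * w s k))"
      by (simp only: comb_def)
  next
    fix c s assume "\<And>i. i < n \<Longrightarrow> (\<Sum>s\<in>I <+> J. c s * w s i) = 0" and s: "s \<in> I <+> J"
    then have comb0: "comb c i = 0" if "i < n" for i using that by (simp add: comb_def)
    \<comment> \<open>As \<open>D k > 0\<close>, the part on \<open>R\<close> vanishes first.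
      Orthonormality of the columns of \<open>V\<close> then kills the coefficients from
      \<open>J\<close>, and evaluation at \<open>i\<close> those from \<open>I\<close>.\<close>
    have z_zero: "z c k = 0" if "k < n" for k
    proof (cases "k \<in> R")
      case True
      then show ?thesis using comb0[OF that] comb_cases[OF that, of c] D[of k] by simp
    qed (use z0 that in blast)
    show "c s = 0"
    proof (cases s)
      case (Inl i)
      then have "i \<in> I" "i < n" using s I_sub by auto
      then show ?thesis using comb0[of i] z_zero[of i] Inl by (simp add: comb)
    next
      case (Inr j)
      then have "j \<in> J" "j < n" using s by (auto simp: J_def)
      then show ?thesis using ip[of j c] z_zero Inr by simp
    qed
  qed
  then have bound: "card I + card J \<le> num_nonneg_eigenvalues A"
    using I_fin J by (simp add: card_Plus)
  have "\<beta> * real (card R) \<le> real (card J)"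
    unfolding J_def by (rule scaled[OF weights _ diag]) (simp add: M_entry)
  moreover have "\<beta> * (real (card I) + real (card (N I))) \<le> real (card I)"
  proof -
    have "\<beta> * (real (card I) + real (card (N I))) \<le> 1 / 2 * (2 * real (card I))"
      using \<beta> card_NI by (intro mult_mono) auto
    then show ?thesis by simp
  qed
  moreover have "real n \<le> real (card I) + real (card (N I)) + real (card R)"
  proof -
    have "{..<n} \<subseteq> I \<union> N I \<union> R" by (auto simp: R_def)
    then have "card {..<n} \<le> card (I \<union> N I \<union> R)"
      using I_fin N_fin R(2) by (intro card_mono) auto
    also have "\<dots> \<le> card I + card (N I) + card R"
      using card_Un_le[of "I \<union> N I" R] card_Un_le[of I "N I"] by linarith
    finally show ?thesis by simp
  qed
  then have "\<beta> * real n \<le> \<beta> * (real (card I) + real (card (N I)) + real (card R))"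
    using \<beta>(1) by (rule mult_left_mono)
  ultimately show ?thesis using bound by (simp add: distrib_left)
qed

section \<open>Short cycles from adjacencies, and the two bounds\<close>

lemma (in pair_graph) C4_free_common_neighbour:
  assumes "C4_free G" "(i, a) \<in> parcs G" "(a, k) \<in> parcs G" "(i, b) \<in> parcs G" "(b, k) \<in> parcs G" "i \<noteq> k"
  shows "a = b"
proof (rule ccontr)
  assume "a \<noteq> b"
  have rev: "(k, b) \<in> parcs G" "(b, i) \<in> parcs G" using assms arcs_symmetric by auto
  let ?p = "[(i, a), (a, k), (k, b), (b, i)]"
  have "awalk i ?p i"
    using assms rev by (auto simp: awalk_def intro: in_arcsD1)
  moreover have "distinct (tl (pawalk_verts i ?p))"
    using assms rev \<open>a \<noteq> b\<close> no_loops' by auto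
  ultimately have "graph_cycle G ?p"
    unfolding graph_cycle_def cycle_def by auto
  then show False using assms(1) by (auto simp: C4_free_def)
qed

lemma (in pair_graph) triangle_cycle:
  assumes "(i, j) \<in> parcs G" "(j, k) \<in> parcs G" "(k, i) \<in> parcs G"
  shows "graph_cycle G [(i, j), (j, k), (k, i)]"
proof -
  let ?p = "[(i, j), (j, k), (k, i)]"
  have "awalk i ?p i"
    using assms by (auto simp: awalk_def intro: in_arcsD1)
  moreover have "distinct (tl (pawalk_verts i ?p))"
    using assms no_loops' by auto
  ultimately show ?thesis
    unfolding graph_cycle_def cycle_def by auto
qed

theorem theorem1p7:
  fixes G :: "nat pair_pre_digraph" and n :: nat and A :: "complex mat"
  assumes "pair_graph G" and "pverts G = {0..<n}"
    and "hermitian_weighted_adjacency G n A"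
  shows "(C4_free G \<longrightarrow> real (num_nonneg_eigenvalues A) \<ge> (sqrt 3 - 3 / 2) * real n) \<and>
         (girth G \<ge> 5 \<longrightarrow> real (num_nonneg_eigenvalues A) \<ge> real n / 4)"
proof -
  interpret pair_graph G by (rule assms(1))
  have A: "A \<in> carrier_mat n n" and herm: "mat_adjoint A = A"
    and supp: "\<And>i k. i < n \<Longrightarrow> k < n \<Longrightarrow> A $$ (i, k) \<noteq> 0 \<Longrightarrow> (i, k) \<in> parcs G"
    using assms(3) by (auto simp: hermitian_weighted_adjacency_def)
  \<comment> \<open>The first moment vanishes because there are no loops, the second comes from the
    row sums, the fourth is bounded by uniqueness of common neighbours, and the third vanishes
    without triangles.\<close>
  have moments: "(\<Sum>j<n. l j) = 0 \<and> (\<Sum>j<n. l j ^ 2) = real (card R) \<and>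
      (\<Sum>j<n. l j ^ 4) \<le> 2 * real (card R) \<and> (girth G \<ge> 5 \<longrightarrow> (\<Sum>j<n. l j ^ 3) = 0)"
    if C4: "C4_free G" and weights: "doubly_stochastic_weights n M R" and diag: "hermitian_diagonalization n M U l"
      and zero: "\<And>i k. i < n \<Longrightarrow> k < n \<Longrightarrow> A $$ (i, k) = 0 \<Longrightarrow> M $$ (i, k) = 0" for M R U l
  proof -
    interpret M: doubly_stochastic_weights n M R by (rule weights)
    interpret D: hermitian_diagonalization n M U l by (rule diag)
    have arc: "(i, k) \<in> parcs G" if "i < n" "k < n" "M $$ (i, k) \<noteq> 0" for i k
      using supp zero that by blast
    have "complex_of_real (\<Sum>j<n. l j) = mat_trace M" by (simp add: D.moments)
    also have "\<dots> = 0"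
      unfolding mat_trace_def using arc no_loops' M.M by (intro sum.neutral) fastforce
    finally have 1: "(\<Sum>j<n. l j) = 0" by (simp only: of_real_eq_0_iff)
    have "complex_of_real (\<Sum>j<n. l j ^ 2) = mat_trace (M * M)" by (simp add: D.moments)
    then have 2: "(\<Sum>j<n. l j ^ 2) = real (card R)" by (simp only: M.trace_square of_real_eq_iff)
    have "complex_of_real (\<Sum>j<n. l j ^ 4) = mat_trace (M * M * (M * M))" by (simp add: D.moments)
    then have "(\<Sum>j<n. l j ^ 4) = Re (mat_trace (M * M * (M * M)))" by (metis Re_complex_of_real)
    moreover have "Re (mat_trace (M * M * (M * M))) \<le> 2 * real (card R)"
      by (rule M.trace_fourth_le) (meson C4_free_common_neighbour[OF C4] arc)
    ultimately have 4: "(\<Sum>j<n. l j ^ 4) \<le> 2 * real (card R)" by simp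
    have "(\<Sum>j<n. l j ^ 3) = 0" if "girth G \<ge> 5"
    proof -
      have "mat_trace (M * M * M) = 0"
      proof (rule M.trace_cube_zero, rule ccontr)
        fix i j k assume "i < n" "j < n" "k < n" "M $$ (i, j) \<noteq> 0" "M $$ (j, k) \<noteq> 0" "M $$ (k, i) \<noteq> 0"
        then have "graph_cycle G [(i, j), (j, k), (k, i)]" by (intro triangle_cycle arc)
        then show False using that unfolding girth_ge_5_iff by force
      qed
      moreover have "complex_of_real (\<Sum>j<n. l j ^ 3) = mat_trace (M * M * M)" by (simp add: D.moments)
      ultimately show ?thesis by (simp only: of_real_eq_0_iff)
    qed
    then show ?thesis using 1 2 4 by blast
  qed
  show ?thesis
  proof (intro conjI impI)
    assume C4: "C4_free G"
    \<comment> \<open>These two estimates place \<open>sqrt 3 - 3 / 2\<close> between 0 and 1/2, as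
      \<open>num_nonneg_eigenvalues_ge\<close> requires.\<close>
    have "3 / 2 \<le> sqrt (3 :: real)" by (rule real_le_rsqrt) (simp add: power_divide)
    moreover have "sqrt (3 :: real) \<le> 2" by (rule real_le_lsqrt) simp_all
    ultimately show "(sqrt 3 - 3 / 2) * real n \<le> real (num_nonneg_eigenvalues A)"
      using moments[OF C4] by (intro num_nonneg_eigenvalues_ge[OF A herm] card_positive_ge_C4) auto
  next
    assume girth: "girth G \<ge> 5"
    then have C4: "C4_free G" unfolding girth_ge_5_iff C4_free_def by blast
    have "1 / 4 * real n \<le> real (num_nonneg_eigenvalues A)"
      using moments[OF C4] girth by (intro num_nonneg_eigenvalues_ge[OF A herm] card_positive_ge_girth5) auto
    then show "real n / 4 \<le> real (num_nonneg_eigenvalues A)" by simp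
  qed
qed

end
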